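(* Let $\mathcal{H}$ be a stable ordered-union ultrafilter on $\mathrm{FIN}$ and let $\mathbb{P}(\mathcal{H})$ be the associated partial order of $\mathcal{H}$-conditions. Then $\mathbb{P}(\mathcal{H})$ preserves all selective ultrafilters on $\omega$.
   Context: $\omega=\{0,1,2,\dots\}$ and each $n\in\omega$ is identified with $\{0,\dots,n-1\}$. A selective ultrafilter on $\omega$ is a non-principal ultrafilter $\mathcal{U}$ on $\omega$ such that for every $f:\omega\to\omega$ there is $A\in\mathcal{U}$ such that $f$ is constant or one-to-one on $A$. A forcing $\mathbb{P}$ preserves an ultrafilter $\mathcal{U}$ on $\omega$ if $\Vdash_{\mathbb{P}}$ "$\{A\subseteq\omega:\exists B\in\mathcal{U}\,[B\subseteq A]\}$ is an ultrafilter on $\omega$". $\mathrm{FIN}$ is the set of non-empty finite subsets of $\omega$. For $s,t\in\mathrm{FIN}$, $s<_{\mathtt{b}}t$ means $\max(s)<\min(t)$. A block sequence is a non-empty $X\subseteq\mathrm{FIN}$ linearly ordered by $<_{\mathtt{b}}$; $X(i)$ is its $i$th member in increasing order (starting from $i=0$). $\mathrm{FIN}^{[\omega]}$ is the set of infinite block sequences. For $A\subseteq\mathrm{FIN}$, $[A]$ is the set of all unions $\bigcup X$ where $X\subseteq A$ is a finite block sequence. An ultrafilter $\mathcal{H}$ on $\mathrm{FIN}$ is an ordered-union ultrafilter if for every $A\in\mathcal{H}$ there is $X\in\mathrm{FIN}^{[\omega]}$ with $[X]\in\mathcal{H}$ and $[X]\subseteq A$. It is stable if for every sequence $\langle X_n:n\in\omega\rangle$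 with $X_n\in\mathrm{FIN}^{[\omega]}$ and $[X_n]\in\mathcal{H}$ for all $n$, there is $Y\in\mathrm{FIN}^{[\omega]}$ with $[Y]\in\mathcal{H}$ such that for every $n$, $Y(i)\in[X_n]$ for all but finitely many $i\in\omega$. Big sets: $\mathcal{P}(l)$ is the power set of $l$, $2^{\mathcal{P}(l)}$ the set of functions $\mathcal{P}(l)\to 2$, and $s^-=s\setminus\{\max(s)\}$ for $s\in\mathrm{FIN}$. For $k\leq l<\omega$ and $s\in\mathrm{FIN}$ with $\max(s)=l$, a set $A\subseteq 2^{\mathcal{P}(l)}$ is $\langle k,s\rangle$-big if for every $\sigma:\mathcal{P}(k)\to 2$ there is $\tau\in A$ such that $\sigma(u)=\tau(u\cup s^-)$ for all $u\in\mathcal{P}(k)$. Trees: $\mathbb{T}=\bigcup_{l\in\omega}\prod_{k\in l}2^{\mathcal{P}(k)}$. A subtree of $\mathbb{T}$ is a subset $T\subseteq\mathbb{T}$ closed under restriction to initial segments. $\mathrm{Lev}_n(T)=\{f\in T:\operatorname{dom}(f)=n\}$ and $\operatorname{succ}_T(f)=\{\sigma: f^\frown\langle\sigma\rangle\in T\}$. The forcing: an $\mathcal{H}$-condition is a subtree $p=T_p\subseteq\mathbb{T}$ such that (1) $\emptyset\in T_p$; (2) for all $f\in T_p$ and $\operatorname{dom}(f)\leq n<\omega$ there is $g\in T_p$ with $f\subseteq g$ and $n\leq\operatorname{dom}(g)$; (3) for each $k\in\omega$, $H_{p,k}\in\mathcal{H}$, where $H_{p,k}=\{s\in\mathrm{FIN}: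 k\leq\max(s)\text{ and for all }f\in\mathrm{Lev}_{\max(s)}(T_p),\ \operatorname{succ}_{T_p}(f)\text{ is }\langle k,s\rangle\text{-big}\}$. $\mathbb{P}(\mathcal{H})$ is the set of $\mathcal{H}$-conditions, ordered by $q\leq p$ iff $T_q\subseteq T_p$. *)

theory Defs
  imports "HOL-Library.FuncSet" "HOL-Library.Sublist"
begin

section \<open>Forcing over an arbitrary preorder\<close>

text \<open>
  A forcing notion is a set \<open>P\<close> of conditions with a relation \<open>le\<close>, where \<open>le q p\<close> means that
  \<open>q\<close> extends \<open>p\<close>.

  A P-name is a set of pairs (name, condition). HOL has no datatype of arbitrary sets of its own
  elements, so a name is given as a partial family of such pairs, indexed by \<open>nat set \<times> 'p\<close>; only
  the range of the family matters. This index type has at least the size of the continuum and of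
  \<open>P\<close>. Hence the names include the canonical names of all ground-model subsets of \<open>\<omega>\<close>, of all
  ground-model families of subsets of \<open>\<omega>\<close>, and (since a nice name for a subset of \<open>\<omega>\<close> is a subset
  of \<open>{check n | n \<in> \<omega>} \<times> P\<close>) a name for every subset of \<open>\<omega>\<close> in the extension. All quantifiers
  in the formula that is forced below range over natural numbers, subsets of \<open>\<omega>\<close>, and elements
  of such a family, so bounding the size of names does not affect its meaning.
\<close>

datatype 'p name = Name (entries: "nat set \<times> 'p \<rightharpoonup> 'p name \<times> 'p")

definition pairs :: "'p name \<Rightarrow> ('p name \<times> 'p) set" where
  "pairs \<tau> = ran (entries \<tau>)"

inductive is_name :: "'p set \<Rightarrow> 'p name \<Rightarrow> bool" for P where
  "(\<And>\<pi> s. (\<pi>, s) \<in> pairs \<tau> \<Longrightarrow> is_name P \<pi> \<and> s \<in> P) \<Longrightarrow> is_name P \<tau>"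

text \<open>
  Canonical names. Natural numbers are von Neumann numerals. As \<open>P\<close> is not assumed to come with a
  distinguished largest condition, a member of a canonical name is paired with every condition.
\<close>

primrec check_nat :: "'p set \<Rightarrow> nat \<Rightarrow> 'p name" where
  "check_nat P 0 = Name (\<lambda>_. None)"
| "check_nat P (Suc n) = Name (\<lambda>(X, p).
     if p \<in> P \<and> X = {n} then Some (check_nat P n, p) else entries (check_nat P n) (X, p))"

definition check_set :: "'p set \<Rightarrow> nat set \<Rightarrow> 'p name" where
  "check_set P B = Name (\<lambda>(X, p).
     if p \<in> P \<and> (\<exists>n\<in>B. X = {n}) then Some (check_nat P (the_elem X), p) else None)"

definition check_family :: "'p set \<Rightarrow> nat set set \<Rightarrow> 'p name" where
  "check_family P U = Name (\<lambda>(B, p). if p \<in> P \<and> B \<in> U then Some (check_set P B, p) else None)"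

lemma pairs_check_nat: "pairs (check_nat P n) = (check_nat P ` {..<n}) \<times> P"
proof (induction n)
  case 0 show ?case by (simp add: pairs_def)
next
  case (Suc n)
  have k: "entries (check_nat P n) (X,p) = None" if "\<forall>k<n. X \<noteq> {k}" for X p n using that
    by (induction n) auto
  have "pairs (check_nat P (Suc n)) = pairs (check_nat P n) \<union> {check_nat P n} \<times> P"
    unfolding pairs_def ran_def using k[of n "{n}"] 
    by (auto split: if_splits) (metis option.distinct(1))+
  then show ?case using Suc by (auto simp: lessThan_Suc)
qed

lemma pairs_check_set: "pairs (check_set P B) = (check_nat P ` B) \<times> P"
  unfolding check_set_def pairs_def ran_def by (auto split: if_splits) (metis the_elem_eq)

lemma pairs_check_family: "pairs (check_family P U) = (check_set P ` U) \<times> P"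
  unfolding check_family_def pairs_def ran_def by (auto split: if_splits)

abbreviation dense_below :: "'p set \<Rightarrow> ('p \<Rightarrow> 'p \<Rightarrow> bool) \<Rightarrow> 'p \<Rightarrow> ('p \<Rightarrow> bool) \<Rightarrow> bool" where
  "dense_below P le p D \<equiv> \<forall>q\<in>P. le q p \<longrightarrow> (\<exists>r\<in>P. le r q \<and> D r)"

lemma wf_pairs: "wf {(\<pi>, \<tau>). \<exists>s. (\<pi>, s) \<in> pairs \<tau>}"
proof (rule wfUNIVI)
  fix Q :: "'a name \<Rightarrow> bool" and \<tau>
  assume step: "\<forall>\<tau>. (\<forall>\<pi>. (\<pi>, \<tau>) \<in> {(\<pi>, \<tau>). \<exists>s. (\<pi>, s) \<in> pairs \<tau>} \<longrightarrow> Q \<pi>) \<longrightarrow> Q \<tau>"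
  show "Q \<tau>"
  proof (induction \<tau>)
    case (Name e)
    have "Q \<pi>" if "(\<pi>, s) \<in> pairs (Name e)" for \<pi> s
    proof -
      obtain i where i: "e i = Some (\<pi>, s)"
        using \<open>(\<pi>, s) \<in> pairs (Name e)\<close> by (auto simp: pairs_def ran_def)
      have "e i \<in> range e" by simp
      moreover have "(\<pi>, s) \<in> set_option (e i)" "\<pi> \<in> Basic_BNFs.fsts (\<pi>, s)"
        using i by (auto simp: fsts.simps)
      ultimately show "Q \<pi>" using Name by metis
    qed
    with step show ?case by blast
  qed
qed

text \<open>The usual recursion for forcing an equation between names.\<close>

function forces_eq ::
  "'p set \<Rightarrow> ('p \<Rightarrow> 'p \<Rightarrow> bool) \<Rightarrow> 'p name \<Rightarrow> 'p name \<Rightarrow> 'p \<Rightarrow> bool" where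
  "forces_eq P le \<sigma> \<tau> p \<longleftrightarrow>
     (\<forall>(\<pi>, s) \<in> pairs \<sigma>. dense_below P le p (\<lambda>q. le q s \<longrightarrow>
        (\<exists>(\<rho>, t) \<in> pairs \<tau>. le q t \<and> forces_eq P le \<pi> \<rho> q))) \<and>
     (\<forall>(\<rho>, t) \<in> pairs \<tau>. dense_below P le p (\<lambda>q. le q t \<longrightarrow>
        (\<exists>(\<pi>, s) \<in> pairs \<sigma>. le q s \<and> forces_eq P le \<pi> \<rho> q)))"
  by pat_completeness auto
termination
  by (relation "inv_image {(\<pi>, \<tau>). \<exists>s. (\<pi>, s) \<in> pairs \<tau>} (\<lambda>(P, le, \<sigma>, \<tau>, p). \<sigma>)")
     (auto intro: wf_pairs)

declare forces_eq.simps [simp del]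

text \<open>
  Sentences of the forcing language, with names as constants; the existential quantifier ranges
  over P-names.
\<close>

datatype 'p sentence =
    FMem "'p name" "'p name"  (infix "\<^bold>\<in>" 50)
  | FEq "'p name" "'p name"  (infix "\<^bold>=" 50)
  | FNot "'p sentence"  ("\<^bold>\<not> _" [40] 40)
  | FAnd "'p sentence" "'p sentence"  (infixr "\<^bold>\<and>" 35)
  | FEx "'p name \<Rightarrow> 'p sentence"  (binder "\<^bold>\<exists>" 10)

primrec forces ::
  "'p set \<Rightarrow> ('p \<Rightarrow> 'p \<Rightarrow> bool) \<Rightarrow> 'p sentence \<Rightarrow> 'p \<Rightarrow> bool" where
  "forces P le (\<sigma> \<^bold>\<in> \<tau>) = (\<lambda>p.
     dense_below P le p (\<lambda>q. \<exists>(\<pi>, s) \<in> pairs \<tau>. le q s \<and> forces_eq P le \<sigma> \<pi> q))"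
| "forces P le (\<sigma> \<^bold>= \<tau>) = (\<lambda>p. forces_eq P le \<sigma> \<tau> p)"
| "forces P le (\<^bold>\<not> \<phi>) = (\<lambda>p. \<not> (\<exists>q\<in>P. le q p \<and> forces P le \<phi> q))"
| "forces P le (\<phi> \<^bold>\<and> \<psi>) = (\<lambda>p. forces P le \<phi> p \<and> forces P le \<psi> p)"
| "forces P le (FEx \<Phi>) = (\<lambda>p.
     dense_below P le p (\<lambda>q. \<exists>\<sigma>. is_name P \<sigma> \<and> forces P le (\<Phi> \<sigma>) q))"

definition FOr :: "'p sentence \<Rightarrow> 'p sentence \<Rightarrow> 'p sentence"  (infixr "\<^bold>\<or>" 30) where
  "(\<phi> \<^bold>\<or> \<psi>) = (\<^bold>\<not> (\<^bold>\<not> \<phi> \<^bold>\<and> \<^bold>\<not> \<psi>))"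

definition FImp :: "'p sentence \<Rightarrow> 'p sentence \<Rightarrow> 'p sentence"  (infixr "\<^bold>\<longrightarrow>" 25) where
  "(\<phi> \<^bold>\<longrightarrow> \<psi>) = (\<^bold>\<not> (\<phi> \<^bold>\<and> \<^bold>\<not> \<psi>))"

definition FIff :: "'p sentence \<Rightarrow> 'p sentence \<Rightarrow> 'p sentence"  (infixr "\<^bold>\<longleftrightarrow>" 25) where
  "(\<phi> \<^bold>\<longleftrightarrow> \<psi>) = ((\<phi> \<^bold>\<longrightarrow> \<psi>) \<^bold>\<and> (\<psi> \<^bold>\<longrightarrow> \<phi>))"

definition FAll :: "('p name \<Rightarrow> 'p sentence) \<Rightarrow> 'p sentence"  (binder "\<^bold>\<forall>" 10) where
  "(\<^bold>\<forall>x. \<Phi> x) = (\<^bold>\<not> (\<^bold>\<exists>x. \<^bold>\<not> \<Phi> x))"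

definition FSub :: "'p name \<Rightarrow> 'p name \<Rightarrow> 'p sentence"  (infix "\<^bold>\<subseteq>" 50) where
  "(\<sigma> \<^bold>\<subseteq> \<tau>) = (\<^bold>\<forall>x. x \<^bold>\<in> \<sigma> \<^bold>\<longrightarrow> x \<^bold>\<in> \<tau>)"

text \<open>
  ``The family of all \<open>A\<close> with \<open>F A\<close> is an ultrafilter on \<open>W\<close>'', where the family is given by a
  formula \<open>F\<close> of the forcing language.
\<close>

definition ultrafilter_sentence :: "'p name \<Rightarrow> ('p name \<Rightarrow> 'p sentence) \<Rightarrow> 'p sentence" where
  "ultrafilter_sentence W F =
     ((\<^bold>\<forall>A. F A \<^bold>\<longrightarrow> A \<^bold>\<subseteq> W) \<^bold>\<and>
      F W \<^bold>\<and>
      (\<^bold>\<forall>A. F A \<^bold>\<longrightarrow> (\<^bold>\<exists>x. x \<^bold>\<in> A)) \<^bold>\<and>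
      (\<^bold>\<forall>A. \<^bold>\<forall>B. \<^bold>\<forall>C. F A \<^bold>\<and> F B \<^bold>\<and> (\<^bold>\<forall>x. x \<^bold>\<in> C \<^bold>\<longleftrightarrow> x \<^bold>\<in> A \<^bold>\<and> x \<^bold>\<in> B) \<^bold>\<longrightarrow> F C) \<^bold>\<and>
      (\<^bold>\<forall>A. \<^bold>\<forall>B. F A \<^bold>\<and> A \<^bold>\<subseteq> B \<^bold>\<and> B \<^bold>\<subseteq> W \<^bold>\<longrightarrow> F B) \<^bold>\<and>
      (\<^bold>\<forall>A. \<^bold>\<forall>C. A \<^bold>\<subseteq> W \<^bold>\<and> (\<^bold>\<forall>x. x \<^bold>\<in> C \<^bold>\<longleftrightarrow> x \<^bold>\<in> W \<^bold>\<and> \<^bold>\<not> x \<^bold>\<in> A) \<^bold>\<longrightarrow> F A \<^bold>\<or> F C))"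

definition preserves :: "'p set \<Rightarrow> ('p \<Rightarrow> 'p \<Rightarrow> bool) \<Rightarrow> nat set set \<Rightarrow> bool" where
  "preserves P le U \<longleftrightarrow>
     (\<forall>p\<in>P. forces P le
        (ultrafilter_sentence (check_set P UNIV)
           (\<lambda>A. A \<^bold>\<subseteq> check_set P UNIV \<^bold>\<and> (\<^bold>\<exists>B. B \<^bold>\<in> check_family P U \<^bold>\<and> B \<^bold>\<subseteq> A))) p)"


section \<open>Ultrafilters\<close>

definition ultrafilter_on :: "'a set \<Rightarrow> 'a set set \<Rightarrow> bool" where
  "ultrafilter_on S F \<longleftrightarrow>
     F \<subseteq> Pow S \<and> S \<in> F \<and> {} \<notin> F \<and>
     (\<forall>A\<in>F. \<forall>B\<in>F. A \<inter> B \<in> F) \<and>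
     (\<forall>A\<in>F. \<forall>B. A \<subseteq> B \<and> B \<subseteq> S \<longrightarrow> B \<in> F) \<and>
     (\<forall>A. A \<subseteq> S \<longrightarrow> A \<in> F \<or> S - A \<in> F)"

definition selective_ultrafilter :: "nat set set \<Rightarrow> bool" where
  "selective_ultrafilter U \<longleftrightarrow>
     ultrafilter_on UNIV U \<and> (\<forall>n. {n} \<notin> U) \<and>
     (\<forall>f :: nat \<Rightarrow> nat. \<exists>A\<in>U. (\<exists>c. \<forall>n\<in>A. f n = c) \<or> inj_on f A)"


section \<open>Block sequences and stable ordered-union ultrafilters\<close>

definition FIN :: "nat set set" where
  "FIN = {s. finite s \<and> s \<noteq> {}}"

definition block_less :: "nat set \<Rightarrow> nat set \<Rightarrow> bool"  (infix "<\<^sub>b" 50) where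
  "s <\<^sub>b t \<longleftrightarrow> Max s < Min t"

definition block_sequence :: "nat set set \<Rightarrow> bool" where
  "block_sequence X \<longleftrightarrow>
     X \<noteq> {} \<and> X \<subseteq> FIN \<and> (\<forall>s\<in>X. \<forall>t\<in>X. s \<noteq> t \<longrightarrow> s <\<^sub>b t \<or> t <\<^sub>b s)"

definition inf_block_sequences :: "nat set set set"  ("FIN\<^sup>\<omega>") where
  "FIN\<^sup>\<omega> = {X. block_sequence X \<and> infinite X}"

text \<open>The member of \<open>X\<close> with exactly \<open>i\<close> predecessors in \<open>X\<close>.\<close>

definition block_nth :: "nat set set \<Rightarrow> nat \<Rightarrow> nat set" where
  "block_nth X i = (THE s. s \<in> X \<and> card {t \<in> X. t <\<^sub>b s} = i)"

definition finite_unions :: "nat set set \<Rightarrow> nat set set"  ("\<langle>_\<rangle>") where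
  "\<langle>A\<rangle> = {\<Union>X | X. X \<subseteq> A \<and> finite X \<and> block_sequence X}"

definition ordered_union_ultrafilter :: "nat set set set \<Rightarrow> bool" where
  "ordered_union_ultrafilter H \<longleftrightarrow>
     ultrafilter_on FIN H \<and> (\<forall>A\<in>H. \<exists>X\<in>FIN\<^sup>\<omega>. \<langle>X\<rangle> \<in> H \<and> \<langle>X\<rangle> \<subseteq> A)"

definition stable_ordered_union_ultrafilter :: "nat set set set \<Rightarrow> bool" where
  "stable_ordered_union_ultrafilter H \<longleftrightarrow>
     ordered_union_ultrafilter H \<and>
     (\<forall>X :: nat \<Rightarrow> nat set set. (\<forall>n. X n \<in> FIN\<^sup>\<omega> \<and> \<langle>X n\<rangle> \<in> H) \<longrightarrow>
        (\<exists>Y\<in>FIN\<^sup>\<omega>. \<langle>Y\<rangle> \<in> H \<and> (\<forall>n. \<exists>m. \<forall>i\<ge>m. block_nth Y i \<in> \<langle>X n\<rangle>)))"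


section \<open>The forcing \<open>\<P>(H)\<close>\<close>

text \<open>
  \<open>2\<close> is rendered as \<open>bool\<close>, and a function on the power set of \<open>k = {..<k}\<close> as an extensional
  function on \<open>nat set\<close>.
\<close>

definition two_Pow :: "nat \<Rightarrow> (nat set \<Rightarrow> bool) set" where
  "two_Pow k = (Pow {..<k} \<rightarrow>\<^sub>E UNIV)"

definition big :: "nat \<Rightarrow> nat set \<Rightarrow> (nat set \<Rightarrow> bool) set \<Rightarrow> bool" where
  "big k s A \<longleftrightarrow>
     (\<forall>\<sigma>\<in>two_Pow k. \<exists>\<tau>\<in>A. \<forall>u\<in>Pow {..<k}. \<sigma> u = \<tau> (u \<union> (s - {Max s})))"

text \<open>Nodes, which are functions with domain some \<open>l \<in> \<omega>\<close>, are lists of length \<open>l\<close>.\<close>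

type_synonym node = "(nat set \<Rightarrow> bool) list"

definition full_tree :: "node set"  ("\<T>") where
  "\<T> = {f. \<forall>k<length f. f ! k \<in> two_Pow k}"

definition subtree :: "node set \<Rightarrow> bool" where
  "subtree T \<longleftrightarrow> T \<subseteq> \<T> \<and> (\<forall>f\<in>T. \<forall>g. prefix g f \<longrightarrow> g \<in> T)"

definition Lev :: "nat \<Rightarrow> node set \<Rightarrow> node set" where
  "Lev n T = {f \<in> T. length f = n}"

definition succs :: "node set \<Rightarrow> node \<Rightarrow> (nat set \<Rightarrow> bool) set" where
  "succs T f = {\<sigma>. f @ [\<sigma>] \<in> T}"

definition big_set :: "node set \<Rightarrow> nat \<Rightarrow> nat set set" where
  "big_set T k = {s \<in> FIN. k \<le> Max s \<and> (\<forall>f\<in>Lev (Max s) T. big k s (succs T f))}"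

definition conditions :: "nat set set set \<Rightarrow> node set set"  ("\<P>") where
  "\<P> H = {T. subtree T \<and> [] \<in> T \<and>
            (\<forall>f\<in>T. \<forall>n\<ge>length f. \<exists>g\<in>T. prefix f g \<and> n \<le> length g) \<and>
            (\<forall>k. big_set T k \<in> H)}"

end

theory Submission
  imports Defs
begin

text \<open>
  By the truth lemma it suffices to find, for a name \<open>A\<close> of a subset of \<open>\<omega>\<close>, a
  condition \<open>q \<le> p\<close> and some \<open>B \<in> U\<close> such that \<open>q\<close> forces every \<open>n \<in> B\<close> into \<open>A\<close>, or forces every
  \<open>n \<in> B\<close> out of \<open>A\<close>. Such a \<open>q\<close> is the limit of a fusion sequence with two kinds of moves: freezing
  the levels up to \<open>Max x\<close> for members \<open>x\<close> of a block sequence, which keeps \<open>x\<close> big, and forcing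
  some \<open>m \<in> B\<close> into \<open>A\<close> without changing the frozen levels. As only finitely many positions can be
  reached before time \<open>n\<close>, stability of \<open>H\<close> and selectivity of \<open>U\<close> provide moves \<open>x\<close> and \<open>m\<close> that
  are legal as long as consecutive ones are far apart. Bigness of \<open>t \<union> x\<close> follows from that of its
  last block \<open>x\<close>, so only moves \<open>m\<close> near to \<open>Max x\<close> can interfere. If this cannot be avoided, then
  \<open>U\<close> is the image of \<open>H\<close> under \<open>s \<mapsto> \<psi> (Max s)\<close> for some \<open>\<psi>\<close>, and then freezing \<open>x\<close> and
  deciding \<open>\<psi> (Max x)\<close> can be done in one move.
\<close>

section \<open>The forcing relation\<close>

text \<open>The moves have to be chosen before the conditions they act on exist. Fixing one outcome
  for every move leaves only finitely many states just after a given time, so legality against all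
  of them is one set in \<open>H\<close> or in \<open>U\<close>; hence diagonalizations are indexed
  by \<open>Suc\<close> of a time. The two ultrafilters are diagonalized separately, so a block
  \<open>x\<close> and a number \<open>m\<close> may still conflict. For fixed \<open>m\<close> only
  finitely many \<open>x\<close> do, and for fixed \<open>x\<close> the conflicting \<open>m\<close>
  lie outside a set in \<open>U\<close>; thus \<open>U\<close> can be thinned until every block
  conflicts with at most one number. This assignment is \<psi>. The remaining case needs a Ramsey
  argument: colour the successors of a node by how \<open>\<psi> (Max s)\<close> is decided above
  them. Either one colour keeps \<open>s\<close> big or the other keeps \<open>t \<union> s\<close>
  big.\<close>

locale forcing_preorder =
  fixes P :: "'p set" and le :: "'p \<Rightarrow> 'p \<Rightarrow> bool"
  assumes le_refl: "le p p" and le_trans: "le r q \<Longrightarrow> le q p \<Longrightarrow> le r p"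
begin

section \<open>Forced equality of names\<close>

lemma forces_eq_memD1:
  assumes "forces_eq P le \<sigma> \<tau> p" "(\<pi>, s) \<in> pairs \<sigma>" "q \<in> P" "le q p" "le q s"
  shows "\<exists>r\<in>P. le r q \<and> (\<exists>(\<rho>, t)\<in>pairs \<tau>. le r t \<and> forces_eq P le \<pi> \<rho> r)"
proof -
  have "dense_below P le p (\<lambda>q. le q s \<longrightarrow>
          (\<exists>(\<rho>, t) \<in> pairs \<tau>. le q t \<and> forces_eq P le \<pi> \<rho> q))"
    using assms(1,2) by (subst (asm) forces_eq.simps) fast
  then show ?thesis using assms(3-5) le_trans by meson
qed

lemma forces_eq_memD2:
  assumes "forces_eq P le \<sigma> \<tau> p" "(\<rho>, t) \<in> pairs \<tau>" "q \<in> P" "le q p" "le q t"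
  shows "\<exists>r\<in>P. le r q \<and> (\<exists>(\<pi>, s)\<in>pairs \<sigma>. le r s \<and> forces_eq P le \<pi> \<rho> r)"
proof -
  have "dense_below P le p (\<lambda>q. le q t \<longrightarrow>
          (\<exists>(\<pi>, s) \<in> pairs \<sigma>. le q s \<and> forces_eq P le \<pi> \<rho> q))"
    using assms(1,2) by (subst (asm) forces_eq.simps) fast
  then show ?thesis using assms(3-5) le_trans by meson
qed

text \<open>Only conditions already below \<open>s\<close> need an extension: a \<open>q\<close>
  that is not below \<open>s\<close> satisfies the implication in the recursion vacuously.\<close>

lemma forces_eqI:
  assumes "\<And>\<pi> s q. (\<pi>, s) \<in> pairs \<sigma> \<Longrightarrow> q \<in> P \<Longrightarrow> le q p \<Longrightarrow> le q s \<Longrightarrow>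
             \<exists>r\<in>P. le r q \<and> (\<exists>(\<rho>, t)\<in>pairs \<tau>. le r t \<and> forces_eq P le \<pi> \<rho> r)"
    and "\<And>\<rho> t q. (\<rho>, t) \<in> pairs \<tau> \<Longrightarrow> q \<in> P \<Longrightarrow> le q p \<Longrightarrow> le q t \<Longrightarrow>
             \<exists>r\<in>P. le r q \<and> (\<exists>(\<pi>, s)\<in>pairs \<sigma>. le r s \<and> forces_eq P le \<pi> \<rho> r)"
  shows "forces_eq P le \<sigma> \<tau> p"
proof (subst forces_eq.simps, intro conjI ballI, safe)
  fix \<pi> s q assume *: "(\<pi>, s) \<in> pairs \<sigma>" "q \<in> P" "le q p"
  show "\<exists>r\<in>P. le r q \<and> (le r s \<longrightarrow> (\<exists>(\<rho>, t)\<in>pairs \<tau>. le r t \<and> forces_eq P le \<pi> \<rho> r))"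
    using assms(1)[OF *] * le_refl by (cases "le q s") blast+
next
  fix \<rho> t q assume *: "(\<rho>, t) \<in> pairs \<tau>" "q \<in> P" "le q p"
  show "\<exists>r\<in>P. le r q \<and> (le r t \<longrightarrow> (\<exists>(\<pi>, s)\<in>pairs \<sigma>. le r s \<and> forces_eq P le \<pi> \<rho> r))"
    using assms(2)[OF *] * le_refl by (cases "le q t") blast+
qed

lemma forces_eq_mono:
  assumes "forces_eq P le \<sigma> \<tau> p" "le q p"
  shows "forces_eq P le \<sigma> \<tau> q"
proof (rule forces_eqI)
  fix \<pi> s r assume "(\<pi>, s) \<in> pairs \<sigma>" "r \<in> P" "le r q" "le r s"
  then show "\<exists>r'\<in>P. le r' r \<and> (\<exists>(\<rho>, t)\<in>pairs \<tau>. le r' t \<and> forces_eq P le \<pi> \<rho> r')"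
    using forces_eq_memD1[OF assms(1)] le_trans[OF _ assms(2)] by simp
next
  fix \<rho> t r assume "(\<rho>, t) \<in> pairs \<tau>" "r \<in> P" "le r q" "le r t"
  then show "\<exists>r'\<in>P. le r' r \<and> (\<exists>(\<pi>, s)\<in>pairs \<sigma>. le r' s \<and> forces_eq P le \<pi> \<rho> r')"
    using forces_eq_memD2[OF assms(1)] le_trans[OF _ assms(2)] by simp
qed

lemma forces_eq_dense:
  assumes "dense_below P le p (forces_eq P le \<sigma> \<tau>)"
  shows "forces_eq P le \<sigma> \<tau> p"
proof (rule forces_eqI)
  fix \<pi> s q assume *: "(\<pi>, s) \<in> pairs \<sigma>" "q \<in> P" "le q p" "le q s"
  then obtain r where r: "r \<in> P" "le r q" "forces_eq P le \<sigma> \<tau> r" using assms by blast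
  then show "\<exists>r\<in>P. le r q \<and> (\<exists>(\<rho>, t)\<in>pairs \<tau>. le r t \<and> forces_eq P le \<pi> \<rho> r)"
    using forces_eq_memD1[OF r(3) *(1) r(1) le_refl le_trans[OF r(2) *(4)]] le_trans by meson
next
  fix \<rho> t q assume *: "(\<rho>, t) \<in> pairs \<tau>" "q \<in> P" "le q p" "le q t"
  then obtain r where r: "r \<in> P" "le r q" "forces_eq P le \<sigma> \<tau> r" using assms by blast
  then show "\<exists>r\<in>P. le r q \<and> (\<exists>(\<pi>, s)\<in>pairs \<sigma>. le r s \<and> forces_eq P le \<pi> \<rho> r)"
    using forces_eq_memD2[OF r(3) *(1) r(1) le_refl le_trans[OF r(2) *(4)]] le_trans by meson
qed

lemma forces_eq_refl: "forces_eq P le \<sigma> \<sigma> p"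
  using wf_pairs
proof (induction \<sigma> arbitrary: p rule: wf_induct_rule)
  case (less \<sigma>)
  then have "forces_eq P le \<pi> \<pi> q" if "(\<pi>, s) \<in> pairs \<sigma>" for \<pi> s q using that by blast
  then show ?case by (intro forces_eqI) (use le_refl in blast)+
qed

lemma forces_eq_sym: "forces_eq P le \<sigma> \<tau> p \<Longrightarrow> forces_eq P le \<tau> \<sigma> p"
  using wf_pairs
proof (induction \<sigma> arbitrary: \<tau> p rule: wf_induct_rule)
  case (less \<sigma>)
  then have IH: "forces_eq P le \<pi> \<rho> q \<Longrightarrow> forces_eq P le \<rho> \<pi> q"
    if "(\<pi>, s) \<in> pairs \<sigma>" for \<pi> s \<rho> q using that by blast
  show ?case
  proof (rule forces_eqI)
    fix \<rho> t q assume *: "(\<rho>, t) \<in> pairs \<tau>" "q \<in> P" "le q p" "le q t"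
    from forces_eq_memD2[OF less.prems *]
    show "\<exists>r\<in>P. le r q \<and> (\<exists>(\<pi>, s)\<in>pairs \<sigma>. le r s \<and> forces_eq P le \<rho> \<pi> r)"
      using IH by blast
  next
    fix \<pi> s q assume *: "(\<pi>, s) \<in> pairs \<sigma>" "q \<in> P" "le q p" "le q s"
    from forces_eq_memD1[OF less.prems *]
    show "\<exists>r\<in>P. le r q \<and> (\<exists>(\<rho>, t)\<in>pairs \<tau>. le r t \<and> forces_eq P le \<rho> \<pi> r)"
      using IH[OF *(1)] by blast
  qed
qed

lemma forces_eq_trans:
  "forces_eq P le \<sigma> \<tau> p \<Longrightarrow> forces_eq P le \<tau> \<upsilon> p \<Longrightarrow> forces_eq P le \<sigma> \<upsilon> p"
  using wf_pairs
proof (induction \<sigma> arbitrary: \<tau> \<upsilon> p rule: wf_induct_rule)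
  case (less \<sigma>)
  then have IH: "forces_eq P le \<pi> \<rho> q \<Longrightarrow> forces_eq P le \<rho> \<chi> q \<Longrightarrow> forces_eq P le \<pi> \<chi> q"
    if "(\<pi>, s) \<in> pairs \<sigma>" for \<pi> s \<rho> \<chi> q using that by blast
  show ?case
  proof (rule forces_eqI)
    fix \<pi> s q assume *: "(\<pi>, s) \<in> pairs \<sigma>" "q \<in> P" "le q p" "le q s"
    obtain r \<rho> t where r: "r \<in> P" "le r q" "(\<rho>, t) \<in> pairs \<tau>" "le r t" "forces_eq P le \<pi> \<rho> r"
      using forces_eq_memD1[OF less.prems(1) *] by blast
    obtain r' \<chi> u where r': "r' \<in> P" "le r' r" "(\<chi>, u) \<in> pairs \<upsilon>" "le r' u" "forces_eq P le \<rho> \<chi> r'"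
      using forces_eq_memD1[OF less.prems(2) r(3,1) le_trans[OF r(2) *(3)] r(4)] by blast
    show "\<exists>r\<in>P. le r q \<and> (\<exists>(\<rho>, t)\<in>pairs \<upsilon>. le r t \<and> forces_eq P le \<pi> \<rho> r)"
      using r' IH[OF *(1) forces_eq_mono[OF r(5) r'(2)] r'(5)] le_trans[OF r'(2) r(2)] by blast
  next
    fix \<chi> u q assume *: "(\<chi>, u) \<in> pairs \<upsilon>" "q \<in> P" "le q p" "le q u"
    obtain r \<rho> t where r: "r \<in> P" "le r q" "(\<rho>, t) \<in> pairs \<tau>" "le r t" "forces_eq P le \<rho> \<chi> r"
      using forces_eq_memD2[OF less.prems(2) *] by blast
    obtain r' \<pi> s where r': "r' \<in> P" "le r' r" "(\<pi>, s) \<in> pairs \<sigma>" "le r' s" "forces_eq P le \<pi> \<rho> r'"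
      using forces_eq_memD2[OF less.prems(1) r(3,1) le_trans[OF r(2) *(3)] r(4)] by blast
    show "\<exists>r\<in>P. le r q \<and> (\<exists>(\<pi>, s)\<in>pairs \<sigma>. le r s \<and> forces_eq P le \<pi> \<chi> r)"
      using r' IH[OF r'(3,5) forces_eq_mono[OF r(5) r'(2)]] le_trans[OF r'(2) r(2)] by blast
  qed
qed

section \<open>Monotonicity, density and the derived connectives\<close>

lemma forces_mono: "forces P le \<phi> p \<Longrightarrow> le q p \<Longrightarrow> forces P le \<phi> q"
proof (induction \<phi> arbitrary: p q)
  case (FEq \<sigma> \<tau>)
  then show ?case by (simp add: forces_eq_mono)
next
  case (FAnd \<phi> \<psi>)
  then show ?case by auto
next
  case (FMem \<sigma> \<tau>)
  then show ?case unfolding forces.simps using le_trans[OF _ FMem.prems(2)] by simp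
next
  case (FNot \<phi>)
  then show ?case unfolding forces.simps using le_trans[OF _ FNot.prems(2)] by blast
next
  case (FEx \<Phi>)
  then show ?case unfolding forces.simps using le_trans[OF _ FEx.prems(2)] by simp
qed

text \<open>With \<open>forces_mono\<close>, this makes the conditions forcing a sentence a regular
  open set, the form in which forcing enters the fusion arguments.\<close>

lemma forces_dense:
  assumes "dense_below P le p (forces P le \<phi>)"
  shows "forces P le \<phi> p"
  using assms
proof (induction \<phi> arbitrary: p)
  case (FMem \<sigma> \<tau>)
  then show ?case unfolding forces.simps using le_refl le_trans by meson
next
  case (FEq \<sigma> \<tau>)
  then show ?case by (simp add: forces_eq_dense)
next
  case (FNot \<phi>)
  show ?case
  proof (clarsimp)
    fix q assume "q \<in> P" "le q p" "forces P le \<phi> q"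
    then show False using FNot.prems forces_mono le_refl by fastforce
  qed
next
  case (FAnd \<phi> \<psi>)
  have "dense_below P le p (forces P le \<phi>)" "dense_below P le p (forces P le \<psi>)"
    using FAnd.prems by auto
  then show ?case using FAnd.IH by simp
next
  case (FEx \<Phi>)
  show ?case
    unfolding forces.simps
  proof (intro ballI impI)
    fix q assume "q \<in> P" "le q p"
    then obtain r where r: "r \<in> P" "le r q" "forces P le (FEx \<Phi>) r" using FEx.prems by blast
    from r(3) have "dense_below P le r (\<lambda>q. \<exists>\<sigma>. is_name P \<sigma> \<and> forces P le (\<Phi> \<sigma>) q)"
      unfolding forces.simps .
    then obtain r' where "r' \<in> P" "le r' r" "\<exists>\<sigma>. is_name P \<sigma> \<and> forces P le (\<Phi> \<sigma>) r'"
      using le_refl r(1) by blast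
    then show "\<exists>r\<in>P. le r q \<and> (\<exists>\<sigma>. is_name P \<sigma> \<and> forces P le (\<Phi> \<sigma>) r)"
      using r(2) le_trans by blast
  qed
qed

text \<open>The coding of implication through negation yields \<psi> only densely;
  \<open>forces_dense\<close> turns this into \<psi> itself.\<close>

lemma forces_FImp:
  "forces P le (\<phi> \<^bold>\<longrightarrow> \<psi>) p \<longleftrightarrow> (\<forall>q\<in>P. le q p \<longrightarrow> forces P le \<phi> q \<longrightarrow> forces P le \<psi> q)"
proof
  assume L: "forces P le (\<phi> \<^bold>\<longrightarrow> \<psi>) p"
  show "\<forall>q\<in>P. le q p \<longrightarrow> forces P le \<phi> q \<longrightarrow> forces P le \<psi> q"
  proof (intro ballI impI)
    fix q assume q: "q \<in> P" "le q p" "forces P le \<phi> q"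
    show "forces P le \<psi> q"
    proof (rule forces_dense, intro ballI impI)
      fix r assume r: "r \<in> P" "le r q"
      show "\<exists>r'\<in>P. le r' r \<and> forces P le \<psi> r'"
        using L[unfolded FImp_def forces.simps] r forces_mono[OF q(3) r(2)] le_trans[OF r(2) q(2)]
        by blast
    qed
  qed
next
  assume "\<forall>q\<in>P. le q p \<longrightarrow> forces P le \<phi> q \<longrightarrow> forces P le \<psi> q"
  then show "forces P le (\<phi> \<^bold>\<longrightarrow> \<psi>) p"
    using le_refl by (auto simp: FImp_def)
qed

lemma forces_FOrI:
  assumes "dense_below P le p (\<lambda>q. forces P le \<phi> q \<or> forces P le \<psi> q)"
  shows "forces P le (\<phi> \<^bold>\<or> \<psi>) p"
  using assms by (auto simp: FOr_def)

lemma forces_FAll: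
  "forces P le (\<^bold>\<forall>x. \<Phi> x) p \<longleftrightarrow> (\<forall>\<sigma>. is_name P \<sigma> \<longrightarrow> forces P le (\<Phi> \<sigma>) p)"
proof
  assume L: "forces P le (\<^bold>\<forall>x. \<Phi> x) p"
  show "\<forall>\<sigma>. is_name P \<sigma> \<longrightarrow> forces P le (\<Phi> \<sigma>) p"
  proof (intro allI impI)
    fix \<sigma> assume \<sigma>: "is_name P \<sigma>"
    show "forces P le (\<Phi> \<sigma>) p"
    proof (rule forces_dense, intro ballI impI, rule ccontr)
      fix q assume q: "q \<in> P" "le q p" "\<not> (\<exists>r\<in>P. le r q \<and> forces P le (\<Phi> \<sigma>) r)"
      have "\<exists>r\<in>P. le r q' \<and> (\<exists>\<sigma>. is_name P \<sigma> \<and> forces P le (\<^bold>\<not> \<Phi> \<sigma>) r)"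
        if "q' \<in> P" "le q' q" for q'
        using \<sigma> le_trans le_refl that q(3) unfolding forces.simps by metis
      then have "forces P le (\<^bold>\<exists>x. \<^bold>\<not> \<Phi> x) q" by simp
      then show False using L q unfolding FAll_def forces.simps(3) by blast
    qed
  qed
next
  assume R: "\<forall>\<sigma>. is_name P \<sigma> \<longrightarrow> forces P le (\<Phi> \<sigma>) p"
  show "forces P le (\<^bold>\<forall>x. \<Phi> x) p"
    unfolding FAll_def forces.simps(3)
  proof (intro notI, elim bexE conjE)
    fix q assume q: "q \<in> P" "le q p" and "forces P le (\<^bold>\<exists>x. \<^bold>\<not> \<Phi> x) q"
    then obtain r \<sigma> where "r \<in> P" "le r q" "is_name P \<sigma>" "forces P le (\<^bold>\<not> \<Phi> \<sigma>) r"
      using le_refl q(1) unfolding forces.simps by blast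
    then show False using R q(2) forces_mono le_refl le_trans unfolding forces.simps by meson
  qed
qed

lemma forces_FSub:
  "forces P le (\<sigma> \<^bold>\<subseteq> \<tau>) p \<longleftrightarrow>
     (\<forall>x. is_name P x \<longrightarrow> (\<forall>q\<in>P. le q p \<longrightarrow> forces P le (x \<^bold>\<in> \<sigma>) q \<longrightarrow> forces P le (x \<^bold>\<in> \<tau>) q))"
  by (simp only: FSub_def forces_FAll forces_FImp)

lemma forces_FIff:
  "forces P le (\<phi> \<^bold>\<longleftrightarrow> \<psi>) p \<longleftrightarrow> (\<forall>q\<in>P. le q p \<longrightarrow> forces P le \<phi> q = forces P le \<psi> q)"
  by (simp only: FIff_def forces.simps forces_FImp) blast

lemma forces_mem_cong_left:
  assumes "forces_eq P le x y p" "forces P le (x \<^bold>\<in> \<tau>) p"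
  shows "forces P le (y \<^bold>\<in> \<tau>) p"
  unfolding forces.simps
proof (intro ballI impI)
  fix q assume q: "q \<in> P" "le q p"
  then obtain r \<pi> s where r: "r \<in> P" "le r q" "(\<pi>, s) \<in> pairs \<tau>" "le r s" "forces_eq P le x \<pi> r"
    using assms(2) unfolding forces.simps by blast
  have "forces_eq P le y \<pi> r"
    using forces_eq_trans[OF forces_eq_sym[OF forces_eq_mono[OF assms(1)]] r(5)] le_trans q r by blast
  then show "\<exists>r\<in>P. le r q \<and> (\<exists>(\<pi>, s)\<in>pairs \<tau>. le r s \<and> forces_eq P le y \<pi> r)"
    using r by blast
qed

lemma forces_mem_cong_right:
  assumes "forces_eq P le \<sigma> \<tau> p" "forces P le (x \<^bold>\<in> \<sigma>) p"
  shows "forces P le (x \<^bold>\<in> \<tau>) p"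
  unfolding forces.simps
proof (intro ballI impI)
  fix q assume q: "q \<in> P" "le q p"
  then obtain r \<pi> s where r: "r \<in> P" "le r q" "(\<pi>, s) \<in> pairs \<sigma>" "le r s" "forces_eq P le x \<pi> r"
    using assms(2) unfolding forces.simps by blast
  obtain r' \<rho> t where r': "r' \<in> P" "le r' r" "(\<rho>, t) \<in> pairs \<tau>" "le r' t" "forces_eq P le \<pi> \<rho> r'"
    using forces_eq_memD1[OF assms(1) r(3,1) le_trans[OF r(2) q(2)] r(4)] by blast
  have "forces_eq P le x \<rho> r'"
    using forces_eq_trans[OF forces_eq_mono[OF r(5) r'(2)] r'(5)] .
  then show "\<exists>r\<in>P. le r q \<and> (\<exists>(\<pi>, s)\<in>pairs \<tau>. le r s \<and> forces_eq P le x \<pi> r)"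
    using r' r(2) le_trans by blast
qed

section \<open>Canonical names\<close>

lemma is_name_check_nat: "is_name P (check_nat P n)"
  by (induction n rule: less_induct) (rule is_name.intros, auto simp: pairs_check_nat)

lemma is_name_check_set: "is_name P (check_set P B)"
  by (rule is_name.intros) (auto simp: pairs_check_set is_name_check_nat)

lemma forces_check_nat_mem: "n \<in> B \<Longrightarrow> forces P le (check_nat P n \<^bold>\<in> check_set P B) p"
  unfolding forces.simps pairs_check_set using le_refl forces_eq_refl by blast

lemma forces_check_set_mem: "B \<in> U \<Longrightarrow> forces P le (check_set P B \<^bold>\<in> check_family P U) p"
  unfolding forces.simps pairs_check_family using le_refl forces_eq_refl by blast

lemma forces_mem_check_setD:
  assumes "forces P le (x \<^bold>\<in> check_set P B) p" "q \<in> P" "le q p"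
  shows "\<exists>r\<in>P. le r q \<and> (\<exists>n\<in>B. forces_eq P le x (check_nat P n) r)"
  using assms unfolding forces.simps pairs_check_set by blast

lemma forces_mem_check_familyD:
  assumes "forces P le (x \<^bold>\<in> check_family P U) p" "q \<in> P" "le q p"
  shows "\<exists>r\<in>P. le r q \<and> (\<exists>B\<in>U. forces_eq P le x (check_set P B) r)"
  using assms unfolding forces.simps pairs_check_family by blast

text \<open>A name forced into a canonical set is, densely, forced equal to a numeral, so numerals
  suffice as test elements.\<close>

lemma forces_check_set_subI:
  assumes "\<And>n. n \<in> B \<Longrightarrow> forces P le (check_nat P n \<^bold>\<in> A) p"
  shows "forces P le (check_set P B \<^bold>\<subseteq> A) p"
  unfolding forces_FSub
proof (intro allI impI ballI)
  fix x q assume q: "q \<in> P" "le q p" and x: "forces P le (x \<^bold>\<in> check_set P B) q"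
  show "forces P le (x \<^bold>\<in> A) q"
  proof (rule forces_dense, intro ballI impI)
    fix q' assume q': "q' \<in> P" "le q' q"
    then obtain r n where r: "r \<in> P" "le r q'" "n \<in> B" "forces_eq P le x (check_nat P n) r"
      using forces_mem_check_setD[OF x] by blast
    have "le r p" using r q' q le_trans by blast
    then have "forces P le (x \<^bold>\<in> A) r"
      using forces_mem_cong_left[OF forces_eq_sym[OF r(4)]] forces_mono[OF assms[OF r(3)]] by blast
    then show "\<exists>r\<in>P. le r q' \<and> forces P le (x \<^bold>\<in> A) r" using r by blast
  qed
qed

lemma forces_subD:
  assumes "forces P le (\<sigma> \<^bold>\<subseteq> \<tau>) p" "is_name P x" "forces P le (x \<^bold>\<in> \<sigma>) p" "p \<in> P"
  shows "forces P le (x \<^bold>\<in> \<tau>) p"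
  using assms(1)[unfolded forces_FSub, rule_format, OF assms(2,4) le_refl assms(3)] .

section \<open>The filter generated by a ground-model ultrafilter\<close>

definition generated :: "nat set set \<Rightarrow> 'p name \<Rightarrow> 'p sentence" where
  "generated U A = (A \<^bold>\<subseteq> check_set P UNIV \<^bold>\<and> (\<^bold>\<exists>B. B \<^bold>\<in> check_family P U \<^bold>\<and> B \<^bold>\<subseteq> A))"

lemma forces_generatedI:
  assumes "forces P le (A \<^bold>\<subseteq> check_set P UNIV) p"
    and "dense_below P le p (\<lambda>q. \<exists>B\<in>U. forces P le (check_set P B \<^bold>\<subseteq> A) q)"
  shows "forces P le (generated U A) p"
proof -
  have "\<exists>r\<in>P. le r q \<and> (\<exists>\<sigma>. is_name P \<sigma> \<and>
      forces P le (\<sigma> \<^bold>\<in> check_family P U \<^bold>\<and> \<sigma> \<^bold>\<subseteq> A) r)" if q: "q \<in> P" "le q p" for q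
  proof -
    obtain r B where "r \<in> P" "le r q" "B \<in> U" "forces P le (check_set P B \<^bold>\<subseteq> A) r"
      using assms(2) q by metis
    then show ?thesis
      using forces_check_set_mem is_name_check_set unfolding forces.simps(4) by blast
  qed
  then show ?thesis
    using assms(1) unfolding generated_def by (simp only: forces.simps(4,5)) blast
qed

text \<open>The witness of the existential quantifier is an arbitrary name; an extension makes it
  equal to the canonical name of a ground-model \<open>B\<close>.\<close>

lemma forces_generatedD:
  assumes "forces P le (generated U A) p" "q \<in> P" "le q p"
  shows "\<exists>r\<in>P. le r q \<and> (\<exists>B\<in>U. forces P le (check_set P B \<^bold>\<subseteq> A) r)"
proof -
  obtain r C where r: "r \<in> P" "le r q" "forces P le (C \<^bold>\<in> check_family P U) r" "forces P le (C \<^bold>\<subseteq> A) r"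
    using bspec[OF conjunct2[OF assms(1)[unfolded generated_def forces.simps(4,5)]] assms(2)] assms(3)
    by (elim impE bexE exE conjE)
  obtain r' B where r': "r' \<in> P" "le r' r" "B \<in> U" "forces_eq P le C (check_set P B) r'"
    using forces_mem_check_familyD[OF r(3,1) le_refl] by blast
  have "forces P le (check_set P B \<^bold>\<subseteq> A) r'"
  proof (rule forces_check_set_subI)
    fix n assume "n \<in> B"
    then have "forces P le (check_nat P n \<^bold>\<in> C) r'"
      using forces_mem_cong_right[OF forces_eq_sym[OF r'(4)]] forces_check_nat_mem by blast
    then show "forces P le (check_nat P n \<^bold>\<in> A) r'"
      using forces_subD[OF forces_mono[OF r(4) r'(2)] is_name_check_nat] r'(1) by blast
  qed
  then show ?thesis using r r' le_trans by blast
qed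

text \<open>The filter clauses pass from \<open>U\<close> to its upward closure. Maximality is the
  clause that concerns new sets, and there \<open>dec\<close> enters: the set \<open>B\<close> it
  provides is itself the witness that \<open>A\<close> or its complement is generated.\<close>

lemma preservesI:
  assumes U: "ultrafilter_on UNIV U"
    and dec: "\<And>A p. p \<in> P \<Longrightarrow> \<exists>q\<in>P. le q p \<and> (\<exists>B\<in>U.
          (\<forall>n\<in>B. forces P le (check_nat P n \<^bold>\<in> A) q) \<or>
          (\<forall>n\<in>B. forces P le (\<^bold>\<not> check_nat P n \<^bold>\<in> A) q))"
  shows "preserves P le U"
  unfolding preserves_def generated_def[symmetric]
proof (intro ballI)
  let ?F = "generated U"
  fix p assume p: "p \<in> P"
  have U1: "UNIV \<in> U" "{} \<notin> U" "\<And>A B. A \<in> U \<Longrightarrow> B \<in> U \<Longrightarrow> A \<inter> B \<in> U"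
    using U unfolding ultrafilter_on_def by auto
  have c1: "forces P le (\<^bold>\<forall>A. ?F A \<^bold>\<longrightarrow> A \<^bold>\<subseteq> check_set P UNIV) p"
    by (simp only: forces_FAll forces_FImp generated_def forces.simps(4)) blast
  have c2: "forces P le (?F (check_set P UNIV)) p"
  proof (rule forces_generatedI)
    show *: "forces P le (check_set P UNIV \<^bold>\<subseteq> check_set P UNIV) q" for q
      by (simp only: forces_FSub) blast
    show "dense_below P le p (\<lambda>q. \<exists>B\<in>U. forces P le (check_set P B \<^bold>\<subseteq> check_set P UNIV) q)"
      using * U1 le_refl by blast
  qed
  have c3: "forces P le (\<^bold>\<forall>A. ?F A \<^bold>\<longrightarrow> (\<^bold>\<exists>x. x \<^bold>\<in> A)) p"
    unfolding forces_FAll forces_FImp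
  proof (intro allI impI ballI)
    fix A q assume q: "q \<in> P" "le q p" and A: "forces P le (?F A) q"
    show "forces P le (\<^bold>\<exists>x. x \<^bold>\<in> A) q"
      unfolding forces.simps(5)
    proof (intro ballI impI)
      fix q' assume q': "q' \<in> P" "le q' q"
      obtain r B where r: "r \<in> P" "le r q'" "B \<in> U" "forces P le (check_set P B \<^bold>\<subseteq> A) r"
        using forces_generatedD[OF A q'] by blast
      obtain n where "n \<in> B" using r U1 by fastforce
      then have "forces P le (check_nat P n \<^bold>\<in> A) r"
        using forces_subD[OF r(4) is_name_check_nat forces_check_nat_mem r(1)] by blast
      then show "\<exists>r\<in>P. le r q' \<and> (\<exists>\<sigma>. is_name P \<sigma> \<and> forces P le (\<sigma> \<^bold>\<in> A) r)"
        using r is_name_check_nat by blast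
    qed
  qed
  have c4: "forces P le (\<^bold>\<forall>A. \<^bold>\<forall>B. \<^bold>\<forall>C. ?F A \<^bold>\<and> ?F B \<^bold>\<and> (\<^bold>\<forall>x. x \<^bold>\<in> C \<^bold>\<longleftrightarrow> x \<^bold>\<in> A \<^bold>\<and> x \<^bold>\<in> B) \<^bold>\<longrightarrow> ?F C) p"
    unfolding forces_FAll forces_FImp
  proof (intro allI impI ballI)
    fix A B C q assume q: "q \<in> P" "le q p"
      and "forces P le (?F A \<^bold>\<and> ?F B \<^bold>\<and> (\<^bold>\<forall>x. x \<^bold>\<in> C \<^bold>\<longleftrightarrow> x \<^bold>\<in> A \<^bold>\<and> x \<^bold>\<in> B)) q"
    then have A: "forces P le (?F A) q" and B: "forces P le (?F B) q"
      and C: "forces P le (\<^bold>\<forall>x. x \<^bold>\<in> C \<^bold>\<longleftrightarrow> x \<^bold>\<in> A \<^bold>\<and> x \<^bold>\<in> B) q"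
      by (simp_all only: forces.simps(4))
    have C': "forces P le (x \<^bold>\<in> C) r \<longleftrightarrow> forces P le (x \<^bold>\<in> A) r \<and> forces P le (x \<^bold>\<in> B) r"
      if "is_name P x" "r \<in> P" "le r q" for x r
      using C that by (simp only: forces_FAll forces_FIff forces.simps(4))
    show "forces P le (?F C) q"
    proof (rule forces_generatedI)
      show "forces P le (C \<^bold>\<subseteq> check_set P UNIV) q"
        using A C' unfolding generated_def forces.simps(4) forces_FSub by blast
      show "dense_below P le q (\<lambda>q. \<exists>B\<in>U. forces P le (check_set P B \<^bold>\<subseteq> C) q)"
      proof (intro ballI impI)
        fix q' assume q': "q' \<in> P" "le q' q"
        obtain r B1 where r: "r \<in> P" "le r q'" "B1 \<in> U" "forces P le (check_set P B1 \<^bold>\<subseteq> A) r"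
          using forces_generatedD[OF A q'] by blast
        obtain r' B2 where r': "r' \<in> P" "le r' r" "B2 \<in> U" "forces P le (check_set P B2 \<^bold>\<subseteq> B) r'"
          using forces_generatedD[OF B r(1)] r q' le_trans by blast
        have r'q: "le r' q" using r r' q' le_trans by blast
        have "forces P le (check_set P (B1 \<inter> B2) \<^bold>\<subseteq> C) r'"
        proof (rule forces_check_set_subI)
          fix n assume "n \<in> B1 \<inter> B2"
          then show "forces P le (check_nat P n \<^bold>\<in> C) r'"
            using C'[OF is_name_check_nat r'(1) r'q]
              forces_subD[OF forces_mono[OF r(4) r'(2)] is_name_check_nat forces_check_nat_mem r'(1)]
              forces_subD[OF r'(4) is_name_check_nat forces_check_nat_mem r'(1)] by blast
        qed
        then show "\<exists>r\<in>P. le r q' \<and> (\<exists>B\<in>U. forces P le (check_set P B \<^bold>\<subseteq> C) r)"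
          using r r' U1 le_trans by blast
      qed
    qed
  qed
  have c5: "forces P le (\<^bold>\<forall>A. \<^bold>\<forall>B. ?F A \<^bold>\<and> A \<^bold>\<subseteq> B \<^bold>\<and> B \<^bold>\<subseteq> check_set P UNIV \<^bold>\<longrightarrow> ?F B) p"
    unfolding forces_FAll forces_FImp
  proof (intro allI impI ballI)
    fix A B q assume q: "q \<in> P" "le q p"
      and "forces P le (?F A \<^bold>\<and> A \<^bold>\<subseteq> B \<^bold>\<and> B \<^bold>\<subseteq> check_set P UNIV) q"
    then have A: "forces P le (?F A) q" and AB: "forces P le (A \<^bold>\<subseteq> B) q"
      and B: "forces P le (B \<^bold>\<subseteq> check_set P UNIV) q"
      by (simp_all only: forces.simps(4))
    show "forces P le (?F B) q"
    proof (rule forces_generatedI[OF B], intro ballI impI)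
      fix q' assume q': "q' \<in> P" "le q' q"
      obtain r C where r: "r \<in> P" "le r q'" "C \<in> U" "forces P le (check_set P C \<^bold>\<subseteq> A) r"
        using forces_generatedD[OF A q'] by blast
      have "forces P le (A \<^bold>\<subseteq> B) r" using forces_mono[OF AB] r q' le_trans by blast
      with r(4) have "forces P le (check_set P C \<^bold>\<subseteq> B) r" unfolding forces_FSub by blast
      then show "\<exists>r\<in>P. le r q' \<and> (\<exists>C\<in>U. forces P le (check_set P C \<^bold>\<subseteq> B) r)"
        using r by blast
    qed
  qed
  have c6: "forces P le (\<^bold>\<forall>A. \<^bold>\<forall>C. A \<^bold>\<subseteq> check_set P UNIV \<^bold>\<and>
      (\<^bold>\<forall>x. x \<^bold>\<in> C \<^bold>\<longleftrightarrow> x \<^bold>\<in> check_set P UNIV \<^bold>\<and> \<^bold>\<not> x \<^bold>\<in> A) \<^bold>\<longrightarrow> ?F A \<^bold>\<or> ?F C) p"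
    unfolding forces_FAll forces_FImp
  proof (intro allI impI ballI)
    fix A C q assume q: "q \<in> P" "le q p"
      and "forces P le (A \<^bold>\<subseteq> check_set P UNIV \<^bold>\<and>
        (\<^bold>\<forall>x. x \<^bold>\<in> C \<^bold>\<longleftrightarrow> x \<^bold>\<in> check_set P UNIV \<^bold>\<and> \<^bold>\<not> x \<^bold>\<in> A)) q"
    then have A: "forces P le (A \<^bold>\<subseteq> check_set P UNIV) q"
      and C: "forces P le (\<^bold>\<forall>x. x \<^bold>\<in> C \<^bold>\<longleftrightarrow> x \<^bold>\<in> check_set P UNIV \<^bold>\<and> \<^bold>\<not> x \<^bold>\<in> A) q"
      by (simp_all only: forces.simps(4))
    have C': "forces P le (x \<^bold>\<in> C) r \<longleftrightarrow>
        forces P le (x \<^bold>\<in> check_set P UNIV) r \<and> forces P le (\<^bold>\<not> x \<^bold>\<in> A) r"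
      if "is_name P x" "r \<in> P" "le r q" for x r
      using C that by (simp only: forces_FAll forces_FIff forces.simps(4))
    show "forces P le (?F A \<^bold>\<or> ?F C) q"
    proof (rule forces_FOrI, intro ballI impI)
      fix q' assume q': "q' \<in> P" "le q' q"
      obtain r B where r: "r \<in> P" "le r q'" "B \<in> U" and
        B: "(\<forall>n\<in>B. forces P le (check_nat P n \<^bold>\<in> A) r) \<or>
          (\<forall>n\<in>B. forces P le (\<^bold>\<not> check_nat P n \<^bold>\<in> A) r)"
        using dec[OF q'(1)] by blast
      have rq: "le r q" using r q' le_trans by blast
      \<comment> \<open>Used with \<open>D = A\<close> or with the complement \<open>D = C\<close>,
        depending on where \<open>B\<close> was forced.\<close>
      have F: "forces P le (?F D) r"
        if D: "forces P le (D \<^bold>\<subseteq> check_set P UNIV) r"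
          and "\<And>n. n \<in> B \<Longrightarrow> forces P le (check_nat P n \<^bold>\<in> D) r" for D
      proof (rule forces_generatedI[OF D], intro ballI impI)
        fix r' assume r': "r' \<in> P" "le r' r"
        have "forces P le (check_set P B \<^bold>\<subseteq> D) r'"
          by (rule forces_check_set_subI) (use that r' forces_mono in blast)
        then show "\<exists>r\<in>P. le r r' \<and> (\<exists>B\<in>U. forces P le (check_set P B \<^bold>\<subseteq> D) r)"
          using r(3) r' le_refl by blast
      qed
      have "forces P le (C \<^bold>\<subseteq> check_set P UNIV) r"
        using C' rq le_trans unfolding forces_FSub by blast
      then have "forces P le (?F A) r \<or> forces P le (?F C) r"
        using B F[OF forces_mono[OF A rq]] F[of C]
          C'[OF is_name_check_nat r(1) rq] forces_check_nat_mem by blast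
      then show "\<exists>r\<in>P. le r q' \<and> (forces P le (?F A) r \<or> forces P le (?F C) r)"
        using r by blast
    qed
  qed
  show "forces P le (ultrafilter_sentence (check_set P UNIV) ?F) p"
    unfolding ultrafilter_sentence_def forces.simps(4)[of P le "FAll _"]
    by (simp only: forces.simps(4) c1 c2 c3 c4 c5 c6 simp_thms)
qed

end

section \<open>Diagonalizing selective and stable ordered-union ultrafilters\<close>

lemma ultrafilter_Int: "ultrafilter_on S F \<Longrightarrow> A \<in> F \<Longrightarrow> B \<in> F \<Longrightarrow> A \<inter> B \<in> F"
  by (auto simp: ultrafilter_on_def)

lemma ultrafilter_superset: "ultrafilter_on S F \<Longrightarrow> A \<in> F \<Longrightarrow> A \<subseteq> B \<Longrightarrow> B \<subseteq> S \<Longrightarrow> B \<in> F"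
  unfolding ultrafilter_on_def by metis

lemma ultrafilter_compl: "ultrafilter_on S F \<Longrightarrow> A \<subseteq> S \<Longrightarrow> A \<notin> F \<Longrightarrow> S - A \<in> F"
  unfolding ultrafilter_on_def by metis

lemma ultrafilter_nonempty: "ultrafilter_on S F \<Longrightarrow> A \<in> F \<Longrightarrow> \<exists>x. x \<in> A"
  unfolding ultrafilter_on_def by (metis equals0I)

lemma ultrafilter_finite_INT:
  assumes "ultrafilter_on S F" "finite I" "\<And>i. i \<in> I \<Longrightarrow> {x \<in> S. \<phi> i x} \<in> F"
  shows "{x \<in> S. \<forall>i\<in>I. \<phi> i x} \<in> F"
  using assms(2,3)
proof (induction I)
  case empty
  then show ?case using assms(1) by (simp add: ultrafilter_on_def)
next
  case (insert i I)
  have "{x \<in> S. \<forall>j\<in>insert i I. \<phi> j x} = {x \<in> S. \<phi> i x} \<inter> {x \<in> S. \<forall>i\<in>I. \<phi> i x}" by auto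
  then show ?case using insert ultrafilter_Int[OF assms(1)] by simp
qed

lemma selective_finite:
  assumes "selective_ultrafilter U" "finite A"
  shows "A \<notin> U"
  using assms(2)
proof (induction A)
  case empty
  then show ?case using assms(1) by (simp add: selective_ultrafilter_def ultrafilter_on_def)
next
  case (insert x A)
  have U: "ultrafilter_on UNIV U" "{x} \<notin> U"
    using assms(1) by (auto simp: selective_ultrafilter_def)
  have "UNIV - {x} \<in> U" "UNIV - A \<in> U"
    using U insert.IH ultrafilter_compl[OF U(1)] by auto
  then have "(UNIV - {x}) \<inter> (UNIV - A) \<in> U"
    using ultrafilter_Int[OF U(1)] by blast
  then show ?case
    using ultrafilter_Int[OF U(1)] ultrafilter_nonempty[OF U(1)] by blast
qed

text \<open>Selectivity is applied twice. The first application gives a set almost contained in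
  every \<open>E n\<close>; the second, to intervals growing faster than the resulting thresholds,
  leaves at most one point in each interval. Using every other interval only then puts the larger of
  two points beyond the threshold of the smaller.\<close>

lemma selective_diagonal:
  assumes sel: "selective_ultrafilter U" and D: "\<And>n. D n \<in> U"
  shows "\<exists>B\<in>U. \<forall>m\<in>B. \<forall>m'\<in>B. m < m' \<longrightarrow> m' \<in> D m"
proof -
  have U: "ultrafilter_on UNIV U" using sel by (simp add: selective_ultrafilter_def)
  have sel': "\<exists>A\<in>U. (\<exists>c. \<forall>n\<in>A. f n = c) \<or> inj_on f A" for f :: "nat \<Rightarrow> nat"
    using sel by (auto simp: selective_ultrafilter_def)
  \<comment> \<open>The requirement \<open>n < m\<close> keeps \<open>m\<close> out of
    \<open>E m\<close>, so that the least index in \<open>f\<close> exists.\<close>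
  define E where "E n = {m. n < m \<and> (\<forall>i\<le>n. m \<in> D i)}" for n
  have E: "E n \<in> U" for n
  proof -
    have "UNIV - {..n} \<in> U" by (rule ultrafilter_compl[OF U]) (auto simp: selective_finite[OF sel])
    moreover have "{m \<in> UNIV. \<forall>i\<in>{..n}. m \<in> D i} \<in> U"
      by (rule ultrafilter_finite_INT[OF U]) (auto simp: D)
    ultimately have "(UNIV - {..n}) \<inter> {m \<in> UNIV. \<forall>i\<in>{..n}. m \<in> D i} \<in> U"
      by (rule ultrafilter_Int[OF U])
    then show ?thesis by (rule ultrafilter_superset[OF U]) (auto simp: E_def)
  qed
  define f where "f m = (LEAST n. m \<notin> E n)" for m
  have f: "m \<notin> E (f m)" for m unfolding f_def by (rule LeastI[of _ m]) (simp add: E_def)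
  obtain A where A: "A \<in> U" "(\<exists>c. \<forall>n\<in>A. f n = c) \<or> inj_on f A" using sel' by blast
  have "inj_on f A"
  proof (rule ccontr)
    assume "\<not> inj_on f A"
    then obtain c where c: "\<forall>n\<in>A. f n = c" using A by blast
    obtain m where "m \<in> A \<inter> E c"
      using ultrafilter_nonempty[OF U ultrafilter_Int[OF U A(1) E]] by blast
    then show False using f c by auto
  qed
  have "\<exists>h. \<forall>m\<in>A. h \<le> m \<longrightarrow> m \<in> E n" for n
  proof -
    have "f ` {m \<in> A. m \<notin> E n} \<subseteq> {..n}" by (auto simp: f_def Least_le)
    then have "finite (f ` {m \<in> A. m \<notin> E n})" using finite_subset by blast
    then have "finite {m \<in> A. m \<notin> E n}"
      using finite_imageD inj_on_subset[OF \<open>inj_on f A\<close>] by (metis (lifting) mem_Collect_eq subsetI)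
    then obtain b where "\<forall>m\<in>{m \<in> A. m \<notin> E n}. m < b" using finite_nat_set_iff_bounded by blast
    then show ?thesis by (intro exI[of _ b]) auto
  qed
  then obtain h where h: "\<And>n m. m \<in> A \<Longrightarrow> h n \<le> m \<Longrightarrow> m \<in> E n" by metis
  define g where "g n = Suc n + (\<Sum>i\<le>n. h i)" for n
  have g_mono: "g m \<le> g n" if "m \<le> n" for m n
    unfolding g_def using that sum_mono2[of "{..n}" "{..m}" h] by simp
  have g_h: "h n \<le> g n" for n unfolding g_def using member_le_sum[of n "{..n}" h] by simp
  \<comment> \<open>The endpoint \<open>a (Suc j)\<close> lies beyond the thresholds
    \<open>h m\<close> of all \<open>m\<close> below \<open>a j\<close>.\<close>
  define a where "a j = (g ^^ j) 0" for j
  have a_Suc: "a (Suc j) = g (a j)" for j by (simp add: a_def)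
  have a_mono: "strict_mono a" by (rule strict_mono_Suc_iff[THEN iffD2]) (auto simp: a_Suc g_def[of "a _"])
  define I where "I m = (LEAST j. m < a j)" for m
  have I: "m < a (I m)" for m
    unfolding I_def
  proof (rule LeastI)
    show "m < a (Suc m)" using strict_mono_imp_increasing[OF a_mono, of "Suc m"] by simp
  qed
  obtain B where B: "B \<in> U" "(\<exists>c. \<forall>n\<in>B. I n = c) \<or> inj_on I B" using sel' by blast
  have "inj_on I B"
  proof (rule ccontr)
    assume "\<not> inj_on I B"
    then obtain c where "\<forall>n\<in>B. I n = c" using B by blast
    then have "B \<subseteq> {..<a c}" using I by auto
    then show False using selective_finite[OF sel] B finite_subset by blast
  qed
  \<comment> \<open>Points in adjacent intervals may be too close; fixing the parity of the index
    rules out adjacency.\<close>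
  obtain C where C: "C \<in> U" "\<And>m m'. m \<in> C \<Longrightarrow> m' \<in> C \<Longrightarrow> even (I m) = even (I m')"
  proof (cases "{m. even (I m)} \<in> U")
    case False
    then have "UNIV - {m. even (I m)} \<in> U" using ultrafilter_compl[OF U] by blast
    then show ?thesis by (rule that) simp
  next
    case True
    then show ?thesis by (rule that) simp
  qed
  have ABC: "A \<inter> B \<inter> C \<in> U" by (intro ultrafilter_Int[OF U] A(1) B(1) C(1))
  have "m' \<in> D m" if m: "m \<in> A \<inter> B \<inter> C" "m' \<in> A \<inter> B \<inter> C" "m < m'" for m m'
  proof -
    have "I m \<le> I m'" unfolding I_def[of m] by (rule Least_le) (use I[of m'] m in simp)
    moreover have "I m \<noteq> I m'" using m \<open>inj_on I B\<close> by (auto simp: inj_on_def)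
    moreover have "even (I m) = even (I m')" using m C by blast
    ultimately have "Suc (I m) < I m'" by presburger
    then have "a (Suc (I m)) \<le> m'" using not_less_Least[of "Suc (I m)" "\<lambda>j. m' < a j"] I_def[of m'] by simp
    moreover have "g m \<le> a (Suc (I m))" unfolding a_Suc using g_mono[of m] I[of m] by simp
    ultimately have "h m \<le> m'" using g_h[of m] by simp
    then show ?thesis using h m unfolding E_def by blast
  qed
  then show ?thesis using ABC by blast
qed

section \<open>Block sequences and their finite unions\<close>

lemma FIN_D: "s \<in> FIN \<Longrightarrow> finite s \<and> s \<noteq> {} \<and> Min s \<in> s \<and> Max s \<in> s \<and> Min s \<le> Max s"
  by (auto simp: FIN_def)

lemma FIN_Un: "s \<in> FIN \<Longrightarrow> t \<in> FIN \<Longrightarrow> s \<union> t \<in> FIN"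
  by (auto simp: FIN_def)

lemma block_less_trans: "s <\<^sub>b t \<Longrightarrow> t \<in> FIN \<Longrightarrow> t <\<^sub>b u \<Longrightarrow> s <\<^sub>b u"
  unfolding block_less_def by (drule FIN_D) (elim conjE, linarith)

lemma block_less_Max: "s <\<^sub>b t \<Longrightarrow> t \<in> FIN \<Longrightarrow> Max s < Max t"
  using FIN_D[of t] by (auto simp: block_less_def)

lemma Max_Un_block: "s \<in> FIN \<Longrightarrow> t \<in> FIN \<Longrightarrow> s <\<^sub>b t \<Longrightarrow> Max (s \<union> t) = Max t"
  using block_less_Max[of s t] by (simp add: FIN_def Max_Un)

lemma block_sequence_Max_less:
  assumes "block_sequence X" "x \<in> X" "y \<in> X" "Max x < Max y"
  shows "x <\<^sub>b y"
proof -
  have "x <\<^sub>b y \<or> y <\<^sub>b x" "x \<in> FIN" using assms by (auto simp: block_sequence_def)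
  then show ?thesis using block_less_Max assms(4) by fastforce
qed

lemma block_sequence_Max_inj: "block_sequence X \<Longrightarrow> inj_on Max X"
  using block_less_Max by (fastforce simp: inj_on_def block_sequence_def)

lemma block_sequence_subset: "block_sequence X \<Longrightarrow> Y \<subseteq> X \<Longrightarrow> Y \<noteq> {} \<Longrightarrow> block_sequence Y"
  unfolding block_sequence_def by blast

lemma finite_unions_subset_FIN: "\<langle>X\<rangle> \<subseteq> FIN"
proof
  fix u assume "u \<in> \<langle>X\<rangle>"
  then obtain F where "u = \<Union>F" "finite F" "block_sequence F" by (auto simp: finite_unions_def)
  then show "u \<in> FIN" by (auto simp: FIN_def block_sequence_def subset_iff)
qed

lemma subset_finite_unions: "X \<subseteq> FIN \<Longrightarrow> X \<subseteq> \<langle>X\<rangle>"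
proof
  fix x assume "X \<subseteq> FIN" "x \<in> X"
  then have "{x} \<subseteq> X" "finite {x}" "block_sequence {x}" "x = \<Union>{x}"
    by (auto simp: block_sequence_def)
  then show "x \<in> \<langle>X\<rangle>" unfolding finite_unions_def by blast
qed

lemma finite_unions_Un:
  assumes "block_sequence X" "s \<in> \<langle>X\<rangle>" "t \<in> \<langle>X\<rangle>"
  shows "s \<union> t \<in> \<langle>X\<rangle>"
proof -
  obtain F G where FG: "s = \<Union>F" "F \<subseteq> X" "finite F" "F \<noteq> {}" "t = \<Union>G" "G \<subseteq> X" "finite G"
    using assms(2,3) by (auto simp: finite_unions_def block_sequence_def)
  then have "s \<union> t = \<Union>(F \<union> G)" "F \<union> G \<subseteq> X" "finite (F \<union> G)" by auto
  moreover have "block_sequence (F \<union> G)" using block_sequence_subset[OF assms(1)] FG by simp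
  ultimately show ?thesis unfolding finite_unions_def by blast
qed

lemma finite_unions_Union:
  assumes "block_sequence X" "finite F" "F \<noteq> {}" "F \<subseteq> \<langle>X\<rangle>"
  shows "\<Union>F \<in> \<langle>X\<rangle>"
  using assms(2-4)
proof (induction F rule: finite_ne_induct)
  case (insert x F)
  then show ?case using finite_unions_Un[OF assms(1)] by simp
qed simp

text \<open>Bigness looks at the maximum of a set, so the last block is split off. The rest
  \<open>t\<close> is again a union of blocks, so its maximum is again that of a block.\<close>

lemma finite_unions_last:
  assumes X: "block_sequence X" and u: "u \<in> \<langle>X\<rangle>"
  shows "\<exists>x\<in>X. Max x = Max u \<and> (u = x \<or> (\<exists>t\<in>\<langle>X\<rangle>. t <\<^sub>b x \<and> u = t \<union> x))"
proof -
  obtain F where F: "u = \<Union>F" "F \<subseteq> X" "finite F" "F \<noteq> {}"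
    using u by (auto simp: finite_unions_def block_sequence_def)
  have uF: "u \<in> FIN" using finite_unions_subset_FIN u by blast
  have FF: "y \<in> FIN" if "y \<in> F" for y using that F X by (auto simp: block_sequence_def)
  obtain x where x: "x \<in> F" "Max u \<in> x" using FIN_D[OF uF] F by blast
  have Mx: "Max y \<le> Max u" if "y \<in> F" for y
  proof -
    have "Max y \<in> u" using FIN_D[OF FF[OF that]] F that by blast
    then show ?thesis using FIN_D[OF uF] by simp
  qed
  have Mxu: "Max x = Max u" using Mx[OF x(1)] x FIN_D[OF FF[OF x(1)]] by (auto intro: antisym)
  have less: "y <\<^sub>b x" if y: "y \<in> F" "y \<noteq> x" for y
  proof -
    have "y <\<^sub>b x \<or> x <\<^sub>b y" using y x F X unfolding block_sequence_def by blast
    then show ?thesis using block_less_Max[OF _ FF[OF y(1)]] Mx[OF y(1)] Mxu by fastforce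
  qed
  have "u = x \<or> (\<exists>t\<in>\<langle>X\<rangle>. t <\<^sub>b x \<and> u = t \<union> x)"
  proof (cases "F = {x}")
    case False
    let ?t = "\<Union>(F - {x})"
    have ne: "F - {x} \<noteq> {}" using False F by blast
    have t: "?t \<in> \<langle>X\<rangle>"
      using F subset_finite_unions[of X] X ne
      by (intro finite_unions_Union[OF X]) (auto simp: block_sequence_def)
    then obtain y where y: "y \<in> F - {x}" "Max ?t \<in> y"
      using finite_unions_subset_FIN FIN_D[of ?t] by blast
    have "Max ?t \<le> Max y" using y FIN_D[OF FF[of y]] by auto
    then have "?t <\<^sub>b x" using less[of y] y by (auto simp: block_less_def)
    moreover have "u = ?t \<union> x" using F x by blast
    ultimately show ?thesis using t by blast
  qed (use F in simp)
  then show ?thesis using x F Mxu by blast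
qed

lemma finite_unions_Max: "block_sequence X \<Longrightarrow> u \<in> \<langle>X\<rangle> \<Longrightarrow> \<exists>x\<in>X. Max x = Max u"
  using finite_unions_last by blast

lemma finite_block_predecessors:
  assumes "X \<subseteq> FIN" shows "finite {t \<in> X. t <\<^sub>b x}"
proof (rule finite_subset)
  show "{t \<in> X. t <\<^sub>b x} \<subseteq> Pow {..Min x}"
    using assms by (auto simp: block_less_def FIN_def subset_iff) (meson Max_ge le_trans less_imp_le)
qed simp

lemma inf_block_sequence_unbounded:
  assumes "X \<in> FIN\<^sup>\<omega>"
  shows "\<exists>x\<in>X. n < Min x"
proof (rule ccontr)
  assume "\<not> (\<exists>x\<in>X. n < Min x)"
  then have "Min ` X \<subseteq> {..n}" by auto
  moreover have "inj_on Min X"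
  proof (rule inj_onI, rule ccontr)
    fix x y assume xy: "x \<in> X" "y \<in> X" "Min x = Min y" "x \<noteq> y"
    then have "x <\<^sub>b y \<or> y <\<^sub>b x" "x \<in> FIN" "y \<in> FIN"
      using assms by (auto simp: inf_block_sequences_def block_sequence_def)
    then show False using xy(3) FIN_D[of x] FIN_D[of y] by (auto simp: block_less_def)
  qed
  ultimately have "finite X" using finite_imageD finite_subset by blast
  then show False using assms by (simp add: inf_block_sequences_def)
qed

lemma block_nth_card:
  assumes X: "block_sequence X" and x: "x \<in> X"
  shows "block_nth X (card {t \<in> X. t <\<^sub>b x}) = x"
  unfolding block_nth_def
proof (rule the_equality)
  have less: "card {t \<in> X. t <\<^sub>b y} < card {t \<in> X. t <\<^sub>b z}" if "y \<in> X" "z \<in> X" "y <\<^sub>b z" for y z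
  proof (rule psubset_card_mono)
    show "finite {t \<in> X. t <\<^sub>b z}" using finite_block_predecessors X by (auto simp: block_sequence_def)
    have "y \<in> FIN" using that X by (auto simp: block_sequence_def)
    then have "\<not> y <\<^sub>b y" using FIN_D[of y] by (auto simp: block_less_def)
    then show "{t \<in> X. t <\<^sub>b y} \<subset> {t \<in> X. t <\<^sub>b z}"
      using that block_less_trans \<open>y \<in> FIN\<close> by blast
  qed
  fix s assume s: "s \<in> X \<and> card {t \<in> X. t <\<^sub>b s} = card {t \<in> X. t <\<^sub>b x}"
  show "s = x"
  proof (rule ccontr)
    assume "s \<noteq> x"
    then have "s <\<^sub>b x \<or> x <\<^sub>b s" using s x X by (auto simp: block_sequence_def)
    then show False using less s x by fastforce
  qed
qed (use x in simp)

text \<open>Turns the indexed form of stability into a bound on minima: a block beyond the maxima of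
  some \<open>m\<close> blocks has at least \<open>m\<close> predecessors, so its index is at least
  \<open>m\<close>.\<close>

lemma block_nth_cofinite:
  assumes "X \<in> FIN\<^sup>\<omega>" "\<forall>i\<ge>m. block_nth X i \<in> A"
  shows "\<exists>k. \<forall>x\<in>X. k \<le> Min x \<longrightarrow> x \<in> A"
proof -
  have X: "block_sequence X" "infinite X" using assms(1) by (auto simp: inf_block_sequences_def)
  obtain F where F: "finite F" "card F = m" "F \<subseteq> X"
    using infinite_arbitrarily_large[OF X(2)] by blast
  obtain k where k: "\<forall>n\<in>Max ` F. n < k"
    using F(1) finite_nat_set_iff_bounded[of "Max ` F"] by blast
  have "x \<in> A" if x: "x \<in> X" "k \<le> Min x" for x
  proof -
    have "F \<subseteq> {t \<in> X. t <\<^sub>b x}" using F k x by (fastforce simp: block_less_def)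
    then have "m \<le> card {t \<in> X. t <\<^sub>b x}"
      using card_mono[OF finite_block_predecessors, of X F x] F X(1) by (simp add: block_sequence_def)
    then show ?thesis using assms(2) block_nth_card[OF X(1) x(1)] by metis
  qed
  then show ?thesis by blast
qed

text \<open>
  Split \<open>s\<close> wherever there is a gap from \<open>y\<close> to beyond \<open>f y\<close>. The parity of the number of pieces is
  a colouring whose homogeneous block sequences are spaced: if \<open>Max s\<close> and \<open>Min t\<close> were close, two
  pieces would merge in \<open>s \<union> t\<close>.
\<close>

definition cluster_starts :: "(nat \<Rightarrow> nat) \<Rightarrow> nat set \<Rightarrow> nat set" where
  "cluster_starts f s = {x \<in> s. \<forall>y\<in>s. y < x \<longrightarrow> f y \<le> x}"

text \<open>Only \<open>Min t\<close> can lose its status in the union. A later element of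
  \<open>t\<close> already has \<open>Min t\<close> below it, and by monotonicity of
  \<open>f\<close> this constraint is at least as strong as any coming from \<open>s\<close>. For
  \<open>Min t\<close> itself the strongest new constraint comes from \<open>Max s\<close>.\<close>

lemma cluster_starts_Un:
  assumes f: "mono f" and st: "s \<in> FIN" "t \<in> FIN" "s <\<^sub>b t"
  shows "cluster_starts f (s \<union> t) = cluster_starts f s \<union>
           (if f (Max s) \<le> Min t then cluster_starts f t else cluster_starts f t - {Min t})"
proof -
  have sx: "y \<le> Max s" if "y \<in> s" for y using that st by (auto simp: FIN_def)
  have tx: "Min t \<le> x" if "x \<in> t" for x using that st by (auto simp: FIN_def)
  have less: "y < x" if "y \<in> s" "x \<in> t" for x y
    using sx[OF that(1)] tx[OF that(2)] st by (auto simp: block_less_def)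
  have Mm: "Max s \<in> s" "Min t \<in> t" using st by (auto simp: FIN_def)
  have left: "x \<in> cluster_starts f (s \<union> t) \<longleftrightarrow> x \<in> cluster_starts f s" if "x \<in> s" for x
    using that less less_asym unfolding cluster_starts_def by blast
  have right: "x \<in> cluster_starts f (s \<union> t) \<longleftrightarrow>
      x \<in> cluster_starts f t \<and> (x = Min t \<longrightarrow> f (Max s) \<le> Min t)" if "x \<in> t" for x
  proof (cases "x = Min t")
    case True
    have "\<not> y < x" if "y \<in> t" for y using tx[OF that] True by simp
    then have "x \<in> cluster_starts f (s \<union> t) \<longleftrightarrow> (\<forall>y\<in>s. f y \<le> x)" "x \<in> cluster_starts f t"
      using that less unfolding cluster_starts_def by auto
    moreover have "(\<forall>y\<in>s. f y \<le> x) \<longleftrightarrow> f (Max s) \<le> x"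
      using Mm(1) monoD[OF f sx] order_trans by blast
    ultimately show ?thesis using True by simp
  next
    case False
    then have "Min t < x" using tx[OF that] by simp
    moreover have "f y \<le> f (Min t)" if "y \<in> s" for y
      using less[OF that Mm(2)] f by (simp add: monoD)
    ultimately have "f y \<le> x" if "y \<in> s" "f (Min t) \<le> x" for y
      using that order_trans by blast
    then have "x \<in> cluster_starts f (s \<union> t) \<longleftrightarrow> x \<in> cluster_starts f t"
      using \<open>x \<in> t\<close> \<open>Min t < x\<close> Mm(2) unfolding cluster_starts_def by auto
    then show ?thesis using False by simp
  qed
  have disj: "s \<inter> t = {}" using less by blast
  have sub: "cluster_starts f u \<subseteq> u" for u by (auto simp: cluster_starts_def)
  show ?thesis
  proof (rule set_eqI)
    fix x
    consider "x \<in> s" "x \<notin> t" | "x \<in> t" "x \<notin> s" | "x \<notin> s" "x \<notin> t" using disj by blast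
    then show "x \<in> cluster_starts f (s \<union> t) \<longleftrightarrow> x \<in> cluster_starts f s \<union>
        (if f (Max s) \<le> Min t then cluster_starts f t else cluster_starts f t - {Min t})"
    proof cases
      case 1
      then have "x \<notin> cluster_starts f t" using sub by blast
      then show ?thesis using left[OF 1(1)] by simp
    next
      case 2
      then have "x \<notin> cluster_starts f s" using sub by blast
      then show ?thesis using right[OF 2(1)] by simp
    next
      case 3
      then have "x \<notin> cluster_starts f u" if "u = s \<or> u = t \<or> u = s \<union> t" for u
        using sub[of u] that by blast
      then show ?thesis by simp
    qed
  qed
qed

lemma card_cluster_starts_Un:
  assumes "mono f" "s \<in> FIN" "t \<in> FIN" "s <\<^sub>b t"
  shows "card (cluster_starts f s) + card (cluster_starts f t) =
           card (cluster_starts f (s \<union> t)) + (if f (Max s) \<le> Min t then 0 else 1)"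
proof -
  have sub: "cluster_starts f u \<subseteq> u" for u by (auto simp: cluster_starts_def)
  then have fin: "finite (cluster_starts f s)" "finite (cluster_starts f t)"
    using assms finite_subset unfolding FIN_def by blast+
  have "y < x" if "y \<in> s" "x \<in> t" for x y
    using that assms Max_ge[of s y] Min_le[of t x] by (auto simp: block_less_def FIN_def)
  then have disj: "cluster_starts f s \<inter> cluster_starts f t = {}" using sub by blast
  have "Min t \<le> x" if "x \<in> t" for x using that assms by (simp add: FIN_def)
  then have "Min t \<in> cluster_starts f t"
    using assms by (auto simp: cluster_starts_def FIN_def)
  then have "card (cluster_starts f t - {Min t}) + 1 = card (cluster_starts f t)"
    using fin by (metis Suc_eq_plus1 card_Suc_Diff1)
  moreover have "cluster_starts f s \<inter> (cluster_starts f t - {Min t}) = {}" using disj by blast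
  ultimately show ?thesis
    using cluster_starts_Un[OF assms] fin disj by (simp add: card_Un_disjoint)
qed

section \<open>Spacing and diagonalization in a stable ordered-union ultrafilter\<close>

locale stable_ordered_union =
  fixes H :: "nat set set set"
  assumes stable_ordered_union: "stable_ordered_union_ultrafilter H"
begin

lemma ultrafilter: "ultrafilter_on FIN H"
  using stable_ordered_union
  by (simp add: stable_ordered_union_ultrafilter_def ordered_union_ultrafilter_def)

lemmas H_Int = ultrafilter_Int[OF ultrafilter]
  and H_superset = ultrafilter_superset[OF ultrafilter]
  and H_compl = ultrafilter_compl[OF ultrafilter]
  and H_nonempty = ultrafilter_nonempty[OF ultrafilter]
  and H_finite_INT = ultrafilter_finite_INT[OF ultrafilter]

lemma ordered_union: "A \<in> H \<Longrightarrow> \<exists>X\<in>FIN\<^sup>\<omega>. \<langle>X\<rangle> \<in> H \<and> \<langle>X\<rangle> \<subseteq> A"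
  using stable_ordered_union
  by (simp add: stable_ordered_union_ultrafilter_def ordered_union_ultrafilter_def)

lemma tail: "{s \<in> FIN. n < Min s} \<in> H"
proof (rule ccontr)
  assume "{s \<in> FIN. n < Min s} \<notin> H"
  then have "FIN - {s \<in> FIN. n < Min s} \<in> H" by (intro H_compl) auto
  then obtain X where X: "X \<in> FIN\<^sup>\<omega>" "\<langle>X\<rangle> \<subseteq> FIN - {s \<in> FIN. n < Min s}"
    using ordered_union by meson
  obtain x where "x \<in> X" "n < Min x" using inf_block_sequence_unbounded[OF X(1)] by blast
  moreover have "X \<subseteq> FIN" using X by (auto simp: inf_block_sequences_def block_sequence_def)
  ultimately show False using X(2) subset_finite_unions[of X] by auto
qed

text \<open>A form of the idempotency of \<open>H\<close>. If the complement of \<open>A\<close>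
  were in \<open>H\<close>, it would contain some \<open>\<langle>X\<rangle>\<close> in
  \<open>H\<close>; this is closed under unions, yet contains \<open>t\<close> and \<open>s\<close>
  with \<open>t \<union> s\<close> in \<open>A\<close>.\<close>

lemma shift_in_H:
  assumes A: "A \<subseteq> FIN"
    and shift: "\<And>t. t \<in> FIN \<Longrightarrow> k < Min t \<Longrightarrow> {s \<in> FIN. t \<union> s \<in> A} \<in> H"
  shows "A \<in> H"
proof (rule ccontr)
  assume "A \<notin> H"
  then have "(FIN - A) \<inter> {s \<in> FIN. k < Min s} \<in> H" using H_compl[OF A] H_Int tail by blast
  then obtain X where X: "X \<in> FIN\<^sup>\<omega>" "\<langle>X\<rangle> \<in> H" "\<langle>X\<rangle> \<subseteq> (FIN - A) \<inter> {s \<in> FIN. k < Min s}"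
    using ordered_union by blast
  have bX: "block_sequence X" using X(1) by (simp add: inf_block_sequences_def)
  obtain t where t: "t \<in> \<langle>X\<rangle>" using H_nonempty[OF X(2)] by blast
  then have "{s \<in> FIN. t \<union> s \<in> A} \<in> H" using shift X(3) by blast
  then obtain s where "s \<in> \<langle>X\<rangle>" "t \<union> s \<in> A" using H_nonempty[OF H_Int[OF X(2)]] by blast
  then show False using finite_unions_Un[OF bX t] X(3) by blast
qed

lemma spaced:
  assumes A: "A \<in> H" and f: "mono f"
  shows "\<exists>X\<in>FIN\<^sup>\<omega>. \<langle>X\<rangle> \<in> H \<and> \<langle>X\<rangle> \<subseteq> A \<and>
           (\<forall>s\<in>\<langle>X\<rangle>. \<forall>t\<in>\<langle>X\<rangle>. s <\<^sub>b t \<longrightarrow> f (Max s) \<le> Min t)"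
proof -
  let ?c = "\<lambda>s. card (cluster_starts f s)"
  let ?E = "{s \<in> FIN. even (?c s)}"
  obtain X where X: "X \<in> FIN\<^sup>\<omega>" "\<langle>X\<rangle> \<in> H" "\<langle>X\<rangle> \<subseteq> A" "\<langle>X\<rangle> \<subseteq> ?E \<or> \<langle>X\<rangle> \<subseteq> FIN - ?E"
  proof (cases "?E \<in> H")
    case True
    from ordered_union[OF H_Int[OF A True]] show ?thesis using that by auto
  next
    case False
    then have "FIN - ?E \<in> H" by (intro H_compl) auto
    from ordered_union[OF H_Int[OF A this]] show ?thesis using that by auto
  qed
  have bX: "block_sequence X" using X(1) by (simp add: inf_block_sequences_def)
  have FIN: "s \<in> FIN" if "s \<in> \<langle>X\<rangle>" for s using that finite_unions_subset_FIN by blast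
  have parity: "even (?c s) \<and> even (?c t) \<and> even (?c (s \<union> t)) \<or>
      odd (?c s) \<and> odd (?c t) \<and> odd (?c (s \<union> t))" if "s \<in> \<langle>X\<rangle>" "t \<in> \<langle>X\<rangle>" for s t
    using X(4) that finite_unions_Un[OF bX that] by blast
  have card: "even (?c s + ?c t) = (even (?c (s \<union> t)) = (f (Max s) \<le> Min t))"
    if "s \<in> \<langle>X\<rangle>" "t \<in> \<langle>X\<rangle>" "s <\<^sub>b t" for s t
    using card_cluster_starts_Un[OF f FIN[OF that(1)] FIN[OF that(2)] that(3)] by simp
  \<comment> \<open>A single pair with a large gap fixes the colour: its counts add up exactly, and
    three odd numbers cannot satisfy this.\<close>
  obtain s where s: "s \<in> \<langle>X\<rangle>" using H_nonempty[OF X(2)] by blast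
  obtain t where t: "t \<in> \<langle>X\<rangle>" "max (Max s) (f (Max s)) < Min t"
    using H_nonempty[OF H_Int[OF X(2) tail[of "max (Max s) (f (Max s))"]]] by blast
  then have "even (?c s)" using parity[OF s t(1)] card[OF s t(1)] by (auto simp: block_less_def)
  then have "even (?c u)" if "u \<in> \<langle>X\<rangle>" for u using parity[OF s that] by blast
  \<comment> \<open>For a close pair one piece is lost in the union, so the three counts could not
    all be even.\<close>
  then have "f (Max u) \<le> Min v" if "u \<in> \<langle>X\<rangle>" "v \<in> \<langle>X\<rangle>" "u <\<^sub>b v" for u v
    using card[OF that] that finite_unions_Un[OF bX that(1,2)] by auto
  then show ?thesis using X by blast
qed

text \<open>Stability controls \<open>D n\<close> only from a threshold \<open>g n\<close> on.
  Spacing by a function that dominates the thresholds puts every later \<open>t\<close> beyond the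
  one belonging to \<open>Suc (Max s)\<close>, the time just after a move at \<open>Max s\<close>.
  The set \<open>D 0\<close> takes care of a first block.\<close>

lemma diagonal:
  assumes D: "\<And>n. D n \<in> H"
  shows "\<exists>X\<in>FIN\<^sup>\<omega>. \<langle>X\<rangle> \<in> H \<and> \<langle>X\<rangle> \<subseteq> D 0 \<and>
           (\<forall>s\<in>\<langle>X\<rangle>. \<forall>t\<in>\<langle>X\<rangle>. s <\<^sub>b t \<longrightarrow> t \<in> D (Suc (Max s)))"
proof -
  obtain X where X: "\<And>n. X n \<in> FIN\<^sup>\<omega>" "\<And>n. \<langle>X n\<rangle> \<in> H" "\<And>n. \<langle>X n\<rangle> \<subseteq> D n"
    using ordered_union[OF D] by metis
  then obtain Y where Y: "Y \<in> FIN\<^sup>\<omega>" "\<langle>Y\<rangle> \<in> H" "\<forall>n. \<exists>m. \<forall>i\<ge>m. block_nth Y i \<in> \<langle>X n\<rangle>"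
    using stable_ordered_union[unfolded stable_ordered_union_ultrafilter_def,
        THEN conjunct2, rule_format, of X] by auto
  have "\<exists>k. \<forall>y\<in>Y. k \<le> Min y \<longrightarrow> y \<in> \<langle>X n\<rangle>" for n
    using block_nth_cofinite[OF Y(1)] Y(3) by blast
  then obtain g where g: "\<And>n y. y \<in> Y \<Longrightarrow> g n \<le> Min y \<Longrightarrow> y \<in> \<langle>X n\<rangle>" by metis
  \<comment> \<open>Summing makes \<open>f\<close> monotone, as \<open>spaced\<close> requires; the
    range goes up to \<open>Suc n\<close> so that \<open>f (Max s)\<close> dominates
    \<open>g (Suc (Max s))\<close>.\<close>
  define f where "f n = (\<Sum>i\<le>Suc n. g i)" for n
  have "mono f" unfolding f_def by (intro monoI sum_mono2) auto
  have f: "g (Suc n) \<le> f n" for n unfolding f_def by (simp add: member_le_sum)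
  have DY: "s \<in> D n" if s: "s \<in> \<langle>Y\<rangle>" "g n \<le> Min s" for s n
  proof -
    obtain F where F: "s = \<Union>F" "F \<subseteq> Y" "finite F" "F \<noteq> {}"
      using s(1) by (auto simp: finite_unions_def block_sequence_def)
    have "finite s" using s finite_unions_subset_FIN by (auto simp: FIN_def)
    have "y \<in> \<langle>X n\<rangle>" if "y \<in> F" for y
    proof (rule g)
      show "y \<in> Y" using that F by blast
      then have "y \<noteq> {}" using Y(1) by (auto simp: inf_block_sequences_def block_sequence_def FIN_def)
      moreover have "y \<subseteq> s" using F that by blast
      ultimately show "g n \<le> Min y" using s(2) \<open>finite s\<close> Min_antimono[of y s] by simp
    qed
    moreover have "block_sequence (X n)" using X(1) by (simp add: inf_block_sequences_def)
    ultimately have "s \<in> \<langle>X n\<rangle>" using F finite_unions_Union[of "X n" F] by blast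
    then show ?thesis using X(3) by blast
  qed
  obtain Z where Z: "Z \<in> FIN\<^sup>\<omega>" "\<langle>Z\<rangle> \<in> H" "\<langle>Z\<rangle> \<subseteq> \<langle>Y\<rangle> \<inter> D 0"
    "\<forall>s\<in>\<langle>Z\<rangle>. \<forall>t\<in>\<langle>Z\<rangle>. s <\<^sub>b t \<longrightarrow> f (Max s) \<le> Min t"
    using spaced[OF H_Int[OF Y(2) D] \<open>mono f\<close>] by blast
  have "t \<in> D (Suc (Max s))" if "s \<in> \<langle>Z\<rangle>" "t \<in> \<langle>Z\<rangle>" "s <\<^sub>b t" for s t
    using DY that Z(3,4) f le_trans by blast
  then show ?thesis using Z by blast
qed

end

section \<open>Big sets and conditions\<close>

text \<open>Only values on subsets of \<open>{..<k}\<close> are tested, so \<sigma> need not be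
  extensional. This lets \<open>big_partition\<close> define \<sigma> by cases on all sets.\<close>

lemma big_iff:
  "big k s A \<longleftrightarrow> (\<forall>\<sigma>. \<exists>\<tau>\<in>A. \<forall>u\<subseteq>{..<k}. \<tau> (u \<union> (s - {Max s})) = \<sigma> u)"
proof
  assume L: "big k s A"
  show "\<forall>\<sigma>. \<exists>\<tau>\<in>A. \<forall>u\<subseteq>{..<k}. \<tau> (u \<union> (s - {Max s})) = \<sigma> u"
  proof
    fix \<sigma> :: "nat set \<Rightarrow> bool"
    have "restrict \<sigma> (Pow {..<k}) \<in> two_Pow k" by (simp add: two_Pow_def)
    from bspec[OF L[unfolded big_def] this] obtain \<tau> where \<tau>: "\<tau> \<in> A"
      "\<forall>u\<in>Pow {..<k}. restrict \<sigma> (Pow {..<k}) u = \<tau> (u \<union> (s - {Max s}))"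
      by (elim bexE)
    have "\<tau> (u \<union> (s - {Max s})) = \<sigma> u" if "u \<subseteq> {..<k}" for u
      using bspec[OF \<tau>(2), of u] that by simp
    then show "\<exists>\<tau>\<in>A. \<forall>u\<subseteq>{..<k}. \<tau> (u \<union> (s - {Max s})) = \<sigma> u" using \<tau>(1) by metis
  qed
next
  assume R: "\<forall>\<sigma>. \<exists>\<tau>\<in>A. \<forall>u\<subseteq>{..<k}. \<tau> (u \<union> (s - {Max s})) = \<sigma> u"
  show "big k s A"
    unfolding big_def
  proof
    fix \<sigma>
    from R[rule_format, of \<sigma>] obtain \<tau> where "\<tau> \<in> A"
      "\<forall>u\<subseteq>{..<k}. \<tau> (u \<union> (s - {Max s})) = \<sigma> u" by (elim bexE)
    then show "\<exists>\<tau>\<in>A. \<forall>u\<in>Pow {..<k}. \<sigma> u = \<tau> (u \<union> (s - {Max s}))"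
      by (metis PowD)
  qed
qed

lemma big_antimono: "big k' s A \<Longrightarrow> k \<le> k' \<Longrightarrow> big k s A"
  unfolding big_iff by (metis lessThan_subset_iff order_trans)

text \<open>If both alternatives fail, with counterexamples \<open>\<sigma>0\<close> and
  \<open>\<sigma>1\<close>, glue these: take \<open>\<sigma>0\<close> on subsets of
  \<open>{..<k}\<close> and \<open>\<sigma>1 (v \<inter> {..<k})\<close> on all other
  \<open>v\<close>. As \<open>t\<close> is non-empty and disjoint from \<open>{..<k}\<close>, a set
  \<open>u \<union> t\<close> is of the second kind and gives back \<open>u\<close>. A member of
  \<open>A\<close> realizing the glued function lies in neither part.\<close>

lemma big_partition:
  assumes A: "big k' s A" "A \<subseteq> A0 \<union> A1" and s: "s \<in> FIN" and t: "t \<in> FIN" "t <\<^sub>b s"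
    and k: "k \<le> Min t" "Max t < k'"
  shows "big k s A0 \<or> big k (t \<union> s) A1"
proof (rule ccontr)
  let ?s = "s - {Max s}"
  have bnd: "k \<le> x" "x < k'" "x < Max s" if "x \<in> t" for x
  proof -
    have "Min t \<le> x" "x \<le> Max t" using that t by (auto simp: FIN_def)
    then show "k \<le> x" "x < k'" "x < Max s" using k block_less_Max[OF t(2) s] by auto
  qed
  have ts: "t \<union> s - {Max (t \<union> s)} = t \<union> ?s"
    using Max_Un_block[OF t(1) s t(2)] bnd(3) by auto
  assume "\<not> (big k s A0 \<or> big k (t \<union> s) A1)"
  then have neg: "\<not> big k s A0" "\<not> big k (t \<union> s) A1" by simp_all
  have "\<exists>\<sigma>. \<forall>\<tau>\<in>A0. \<not> (\<forall>u\<subseteq>{..<k}. \<tau> (u \<union> ?s) = \<sigma> u)"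
    using neg(1) unfolding big_iff by (simp only: not_all bex_simps simp_thms)
  then obtain \<sigma>0 where 0: "\<forall>\<tau>\<in>A0. \<not> (\<forall>u\<subseteq>{..<k}. \<tau> (u \<union> ?s) = \<sigma>0 u)" by (elim exE)
  have "\<exists>\<sigma>. \<forall>\<tau>\<in>A1. \<not> (\<forall>u\<subseteq>{..<k}. \<tau> (u \<union> (t \<union> ?s)) = \<sigma> u)"
    using neg(2) unfolding big_iff ts by (simp only: not_all bex_simps simp_thms)
  then obtain \<sigma>1 where 1: "\<forall>\<tau>\<in>A1. \<not> (\<forall>u\<subseteq>{..<k}. \<tau> (u \<union> (t \<union> ?s)) = \<sigma>1 u)" by (elim exE)
  from A(1)[unfolded big_iff, THEN spec, of "\<lambda>v. if v \<subseteq> {..<k} then \<sigma>0 v else \<sigma>1 (v \<inter> {..<k})"]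
  obtain \<tau> where \<tau>: "\<tau> \<in> A"
    "\<forall>v\<subseteq>{..<k'}. \<tau> (v \<union> ?s) = (if v \<subseteq> {..<k} then \<sigma>0 v else \<sigma>1 (v \<inter> {..<k}))"
    by (elim bexE)
  obtain x where x: "x \<in> t" using t(1) by (auto simp: FIN_def)
  have kk: "k \<le> k'" using bnd(1,2)[OF x] by simp
  from \<tau>(1) A(2) consider "\<tau> \<in> A0" | "\<tau> \<in> A1" by blast
  then show False
  proof cases
    case 1
    from bspec[OF 0 this] obtain u where u: "u \<subseteq> {..<k}" "\<tau> (u \<union> ?s) \<noteq> \<sigma>0 u" by auto
    then have "u \<subseteq> {..<k'}" using kk by auto
    then show False using u \<tau>(2)[THEN spec, of u] by simp
  next
    case 2
    from bspec[OF 1 this] obtain u where u: "u \<subseteq> {..<k}" "\<tau> (u \<union> (t \<union> ?s)) \<noteq> \<sigma>1 u" by auto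
    have "u \<union> t \<subseteq> {..<k'}" using u kk bnd(2) by auto
    then have "\<tau> ((u \<union> t) \<union> ?s) =
        (if u \<union> t \<subseteq> {..<k} then \<sigma>0 (u \<union> t) else \<sigma>1 ((u \<union> t) \<inter> {..<k}))"
      using \<tau>(2) by (simp only: simp_thms)
    moreover have "\<not> u \<union> t \<subseteq> {..<k}" using x bnd(1)[OF x] by auto
    moreover have "(u \<union> t) \<inter> {..<k} = u" using u(1) bnd(1) by force
    ultimately have "\<tau> ((u \<union> t) \<union> ?s) = \<sigma>1 u" by (simp only: if_False)
    then show False using u(2) by (simp only: Un_assoc simp_thms)
  qed
qed

lemma big_Un:
  assumes "big k' s A" "s \<in> FIN" "t \<in> FIN" "t <\<^sub>b s" "k \<le> Min t" "Max t < k'"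
  shows "big k (t \<union> s) A"
proof -
  have "\<not> big k s {}" by (simp add: big_iff)
  then show ?thesis using big_partition[of k' s A "{}" A t k] assms by simp
qed

lemma big_set_antimono: "k \<le> k' \<Longrightarrow> big_set T k' \<subseteq> big_set T k"
  using big_antimono by (auto simp: big_set_def)

lemma big_set_Un:
  assumes s: "s \<in> big_set T k'" and t: "t \<in> FIN" "t <\<^sub>b s" "k \<le> Min t" "Max t < k'"
  shows "t \<union> s \<in> big_set T k"
proof -
  have sF: "s \<in> FIN" "k' \<le> Max s" using s by (auto simp: big_set_def)
  have "Max (t \<union> s) = Max s" by (rule Max_Un_block[OF t(1) sF(1) t(2)])
  moreover have "k \<le> Max s" using FIN_D[OF t(1)] t sF by linarith
  ultimately show ?thesis
    using s big_Un[OF _ sF(1) t] FIN_Un[OF t(1) sF(1)] by (auto simp: big_set_def)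
qed

text \<open>Bigness of \<open>s\<close> depends on two levels of the tree only, so it survives in
  the limit once the levels up to \<open>Suc (Max s)\<close> are frozen.\<close>

lemma big_set_cong:
  assumes "Lev (Max s) T = Lev (Max s) T'" "Lev (Suc (Max s)) T = Lev (Suc (Max s)) T'"
  shows "s \<in> big_set T k \<longleftrightarrow> s \<in> big_set T' k"
proof -
  have "succs T f = succs T' f" if "f \<in> Lev (Max s) T" for f
  proof -
    have len: "length f = Max s" using that by (simp add: Lev_def)
    have "f @ [\<sigma>] \<in> Lev (Suc (Max s)) S \<longleftrightarrow> f @ [\<sigma>] \<in> S" for \<sigma> S
      by (simp add: Lev_def len)
    then have "f @ [\<sigma>] \<in> T \<longleftrightarrow> f @ [\<sigma>] \<in> T'" for \<sigma> using assms(2) by metis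
    then show ?thesis by (simp add: succs_def)
  qed
  then show ?thesis using assms(1) by (simp add: big_set_def)
qed

text \<open>Separated from bigness because the limit of a fusion is always such a tree, whereas its
  bigness has to be derived from the moves that were played.\<close>

definition pretree :: "node set \<Rightarrow> bool" where
  "pretree T \<longleftrightarrow> subtree T \<and> [] \<in> T \<and> (\<forall>f\<in>T. \<forall>n\<ge>length f. \<exists>g\<in>T. prefix f g \<and> n \<le> length g)"

lemma conditions_iff: "T \<in> \<P> H \<longleftrightarrow> pretree T \<and> (\<forall>k. big_set T k \<in> H)"
  by (auto simp: conditions_def pretree_def)

lemma pretree_prefix: "pretree T \<Longrightarrow> f \<in> T \<Longrightarrow> prefix g f \<Longrightarrow> g \<in> T"
  by (auto simp: pretree_def subtree_def)

lemma pretree_take: "pretree T \<Longrightarrow> f \<in> T \<Longrightarrow> take n f \<in> T"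
  using pretree_prefix take_is_prefix by blast

lemma pretree_extend:
  assumes "pretree T" "f \<in> T" "length f \<le> n"
  shows "\<exists>g\<in>Lev n T. prefix f g"
proof -
  obtain g where g: "g \<in> T" "prefix f g" "n \<le> length g"
    using assms unfolding pretree_def by blast
  have "prefix f (take n g)" using g assms(3) by (auto simp: prefix_def)
  moreover have "take n g \<in> Lev n T" using pretree_take[OF assms(1) g(1)] g(3) by (simp add: Lev_def)
  ultimately show ?thesis by blast
qed

lemma pretree_Lev: "pretree T \<Longrightarrow> \<exists>f. f \<in> Lev n T"
  using pretree_extend[of T "[]" n] by (auto simp: pretree_def)

lemma pretree_Lev_take:
  assumes "pretree T" "m \<le> n"
  shows "Lev m T = take m ` Lev n T"
proof
  show "take m ` Lev n T \<subseteq> Lev m T" using assms pretree_take by (auto simp: Lev_def)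
  show "Lev m T \<subseteq> take m ` Lev n T"
  proof
    fix f assume f: "f \<in> Lev m T"
    then obtain g where g: "g \<in> Lev n T" "prefix f g"
      using pretree_extend[of T f n] assms by (auto simp: Lev_def)
    then have "f = take m g" using f by (auto simp: Lev_def prefix_def)
    then show "f \<in> take m ` Lev n T" using g by blast
  qed
qed

text \<open>Finiteness allows one condition for each node of a level to be amalgamated, with all
  their requirements met by one set of the ultrafilter.\<close>

lemma finite_Lev: "pretree T \<Longrightarrow> finite (Lev n T)"
proof -
  assume T: "pretree T"
  let ?A = "\<Union>k<n. two_Pow k"
  have "finite ?A" by (auto simp: two_Pow_def intro!: finite_PiE)
  then have "finite {xs. set xs \<subseteq> ?A \<and> length xs = n}" by (rule finite_lists_length_eq)
  moreover have "Lev n T \<subseteq> {xs. set xs \<subseteq> ?A \<and> length xs = n}"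
  proof
    fix f assume f: "f \<in> Lev n T"
    then have "\<forall>k<n. f ! k \<in> two_Pow k" "length f = n"
      using T by (auto simp: Lev_def pretree_def subtree_def full_tree_def)
    have "set f \<subseteq> ?A"
    proof
      fix x assume "x \<in> set f"
      then obtain i where "i < length f" "x = f ! i" by (auto simp: in_set_conv_nth)
      then show "x \<in> ?A" using \<open>\<forall>k<n. f ! k \<in> two_Pow k\<close> \<open>length f = n\<close> by blast
    qed
    then show "f \<in> {xs. set xs \<subseteq> ?A \<and> length xs = n}" using \<open>length f = n\<close> by simp
  qed
  ultimately show ?thesis by (rule rev_finite_subset)
qed

section \<open>Cones and amalgamation of conditions\<close>

definition cone :: "node set \<Rightarrow> node \<Rightarrow> node set" where
  "cone T f = {g \<in> T. prefix f g \<or> prefix g f}"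

lemma cone_subset: "cone T f \<subseteq> T"
  by (auto simp: cone_def)

text \<open>A pretree has nodes of every length, and \<open>f\<close> is the only node of its length
  in the cone.\<close>

lemma cone_stem:
  assumes q: "pretree q" "q \<subseteq> cone p f"
  shows "f \<in> q" and "g \<in> q \<Longrightarrow> length f \<le> length g \<Longrightarrow> prefix f g"
proof -
  have pre: "prefix f g" if "g \<in> q" "length f \<le> length g" for g
    using that q(2) by (auto simp: cone_def prefix_def)
  then show "g \<in> q \<Longrightarrow> length f \<le> length g \<Longrightarrow> prefix f g" .
  obtain g where "g \<in> Lev (length f) q" using pretree_Lev[OF q(1)] by blast
  then show "f \<in> q" using pre[of g] by (auto simp: Lev_def prefix_def)
qed

context stable_ordered_union
begin

lemma tail_Max: "{s \<in> FIN. n < Max s} \<in> H"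
proof (rule H_superset[OF tail[of n]])
  show "{s \<in> FIN. n < Min s} \<subseteq> {s \<in> FIN. n < Max s}" using FIN_D by fastforce
qed auto

text \<open>Beyond \<open>f\<close> the successor sets are those of \<open>p\<close>, and the blocks
  \<open>s\<close> with \<open>length f < Max s\<close> form a set in \<open>H\<close>.\<close>

lemma cone_condition:
  assumes p: "p \<in> \<P> H" and f: "f \<in> p"
  shows "cone p f \<in> \<P> H"
  unfolding conditions_iff
proof
  have pp: "pretree p" using p by (simp add: conditions_iff)
  show "pretree (cone p f)"
    unfolding pretree_def
  proof (intro conjI ballI allI impI)
    show "subtree (cone p f)"
      unfolding subtree_def
    proof (intro conjI ballI allI impI)
      show "cone p f \<subseteq> \<T>" using pp cone_subset by (auto simp: pretree_def subtree_def)
      fix g h assume gh: "g \<in> cone p f" "prefix h g"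
      then have "h \<in> p" using pretree_prefix[OF pp] by (auto simp: cone_def)
      moreover have "prefix f h \<or> prefix h f"
        using gh prefix_same_cases[of f g h] prefix_order.trans[of h g f] by (auto simp: cone_def)
      ultimately show "h \<in> cone p f" by (simp add: cone_def)
    qed
    show "[] \<in> cone p f" using pp by (simp add: cone_def pretree_def)
    fix g n assume g: "g \<in> cone p f" "length g \<le> n"
    show "\<exists>h\<in>cone p f. prefix g h \<and> n \<le> length h"
    proof (cases "prefix f g")
      case True
      obtain h where h: "h \<in> Lev n p" "prefix g h"
        using pretree_extend[OF pp, of g n] g by (auto simp: cone_def)
      then have "prefix f h" using True prefix_order.trans by blast
      then show ?thesis using h by (intro bexI[of _ h]) (auto simp: cone_def Lev_def)
    next
      case False
      then have "prefix g f" using g by (simp add: cone_def)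
      obtain h where h: "h \<in> Lev (max n (length f)) p" "prefix f h"
        using pretree_extend[OF pp f, of "max n (length f)"] by auto
      then have "prefix g h" using \<open>prefix g f\<close> prefix_order.trans by blast
      then show ?thesis using h by (intro bexI[of _ h]) (auto simp: cone_def Lev_def)
    qed
  qed
  show "\<forall>k. big_set (cone p f) k \<in> H"
  proof
    fix k
    have "s \<in> big_set (cone p f) k" if s: "s \<in> big_set p k" "length f < Max s" for s
    proof -
      have "g \<in> Lev (Max s) p \<and> succs (cone p f) g = succs p g" if g: "g \<in> Lev (Max s) (cone p f)" for g
      proof -
        have "prefix f g" using g s(2) by (auto simp: Lev_def cone_def prefix_def)
        then show ?thesis using g by (auto simp: succs_def cone_def Lev_def)
      qed
      then show ?thesis using s(1) by (simp add: big_set_def)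
    qed
    then have sub: "big_set p k \<inter> {s \<in> FIN. length f < Max s} \<subseteq> big_set (cone p f) k" by blast
    have "big_set p k \<inter> {s \<in> FIN. length f < Max s} \<in> H"
      using p by (intro H_Int tail_Max) (simp add: conditions_iff)
    from H_superset[OF this sub] show "big_set (cone p f) k \<in> H" by (auto simp: big_set_def)
  qed
qed

end

text \<open>Two uses determine the generality of \<open>F\<close>: it will be a whole level of a
  condition, or a set of chosen successors of a single node.\<close>

locale amalgamation = stable_ordered_union +
  fixes F :: "node set" and n :: nat and q :: "node \<Rightarrow> node set" and p :: "node set"
  assumes F: "finite F" "F \<noteq> {}" "\<And>f. f \<in> F \<Longrightarrow> length f = n"
    and q: "\<And>f. f \<in> F \<Longrightarrow> q f \<in> \<P> H" "\<And>f. f \<in> F \<Longrightarrow> q f \<subseteq> cone p f"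
begin

abbreviation "Q \<equiv> \<Union>f\<in>F. q f"

lemma q_pretree: "f \<in> F \<Longrightarrow> pretree (q f)"
  using q(1) by (simp add: conditions_iff)

lemma stem: "f \<in> F \<Longrightarrow> f \<in> q f"
  using cone_stem(1) q_pretree q(2) by blast

lemma stem_prefix: "f \<in> F \<Longrightarrow> g \<in> q f \<Longrightarrow> n \<le> length g \<Longrightarrow> prefix f g"
  using cone_stem(2)[OF q_pretree q(2)] F(3) by simp

lemma Lev_Q: "Lev n Q = F"
proof
  show "F \<subseteq> Lev n Q" using stem F by (auto simp: Lev_def)
  show "Lev n Q \<subseteq> F"
  proof
    fix g assume "g \<in> Lev n Q"
    then obtain f where f: "f \<in> F" "g \<in> q f" "length g = n" by (auto simp: Lev_def)
    then have "prefix f g" using stem_prefix by simp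
    then have "g = f" using f F(3)[OF f(1)] by (auto simp: prefix_def)
    then show "g \<in> F" using f by simp
  qed
qed

text \<open>A node of length at least \<open>n\<close> determines \<open>f\<close> as its initial
  segment of length \<open>n\<close>, so its extensions in \<open>Q\<close> all belong to the same
  piece.\<close>

lemma Q_above:
  assumes "g \<in> Q" "n \<le> length g"
  shows "\<exists>f\<in>F. g \<in> q f \<and> succs Q g = succs (q f) g"
proof -
  obtain f where f: "f \<in> F" "g \<in> q f" using assms(1) by blast
  have fg: "prefix f g" using stem_prefix f assms(2) by blast
  have qf: "h \<in> q f" if "h \<in> Q" "prefix g h" for h
  proof -
    obtain f' where f': "f' \<in> F" "h \<in> q f'" using \<open>h \<in> Q\<close> by blast
    have "n \<le> length h" using assms(2) prefix_length_le[OF \<open>prefix g h\<close>] by simp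
    then have "prefix f' h" using stem_prefix f' by blast
    moreover have "prefix f h" using fg \<open>prefix g h\<close> prefix_order.trans by blast
    ultimately have "f = f'"
      using F(3)[OF f(1)] F(3)[OF f'(1)] by (auto simp: prefix_def append_eq_append_conv)
    then show ?thesis using f' by simp
  qed
  have "g @ [\<sigma>] \<in> Q \<longleftrightarrow> g @ [\<sigma>] \<in> q f" for \<sigma>
  proof
    show "g @ [\<sigma>] \<in> Q \<Longrightarrow> g @ [\<sigma>] \<in> q f" using qf by (simp only: prefixI)
    show "g @ [\<sigma>] \<in> q f \<Longrightarrow> g @ [\<sigma>] \<in> Q" using f(1) by blast
  qed
  then have "succs Q g = succs (q f) g" by (simp only: succs_def)
  then show ?thesis using f by blast
qed

lemma big_set_Q:
  assumes "s \<in> FIN" "n \<le> Max s" "\<And>f. f \<in> F \<Longrightarrow> s \<in> big_set (q f) k"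
  shows "s \<in> big_set Q k"
proof -
  have "big k s (succs Q g)" if g: "g \<in> Lev (Max s) Q" for g
  proof -
    obtain f where f: "f \<in> F" "g \<in> q f" "succs Q g = succs (q f) g"
      using Q_above[of g] g assms(2) by (auto simp: Lev_def)
    then have "g \<in> Lev (Max s) (q f)" using g by (simp add: Lev_def)
    then show ?thesis using f assms(3)[OF f(1)] by (simp add: big_set_def)
  qed
  moreover obtain f where "f \<in> F" using F(2) by blast
  ultimately show ?thesis using assms(1) assms(3)[of f] by (simp add: big_set_def)
qed

lemma Q_condition: "Q \<in> \<P> H"
  unfolding conditions_iff
proof
  show "pretree Q"
    unfolding pretree_def
  proof (intro conjI ballI allI impI)
    show "subtree Q" using q_pretree by (fastforce simp: pretree_def subtree_def)
    show "[] \<in> Q" using q_pretree F(2) by (auto simp: pretree_def)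
    fix g m assume g: "g \<in> Q" "length g \<le> m"
    then obtain f where f: "f \<in> F" "g \<in> q f" by blast
    obtain h where "h \<in> Lev m (q f)" "prefix g h"
      using pretree_extend[OF q_pretree[OF f(1)] f(2) g(2)] by blast
    then show "\<exists>h\<in>Q. prefix g h \<and> m \<le> length h"
      using f(1) by (intro bexI[of _ h]) (auto simp: Lev_def)
  qed
  show "\<forall>k. big_set Q k \<in> H"
  proof
    fix k
    have "{s \<in> FIN. \<forall>f\<in>F. s \<in> big_set (q f) k} \<in> H"
    proof (rule H_finite_INT[OF F(1)])
      fix f assume "f \<in> F"
      then have "big_set (q f) k \<in> H" using q(1) by (simp add: conditions_iff)
      moreover have "{s \<in> FIN. s \<in> big_set (q f) k} = big_set (q f) k" by (auto simp: big_set_def)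
      ultimately show "{s \<in> FIN. s \<in> big_set (q f) k} \<in> H" by simp
    qed
    from H_Int[OF this tail_Max[of n]] show "big_set Q k \<in> H"
    proof (rule H_superset)
      show "{s \<in> FIN. \<forall>f\<in>F. s \<in> big_set (q f) k} \<inter> {s \<in> FIN. n < Max s} \<subseteq> big_set Q k"
        using big_set_Q by auto
    qed (auto simp: big_set_def)
  qed
qed

text \<open>The pieces are predense below \<open>Q\<close>: a node of \<open>r\<close> at level
  \<open>n\<close> is some \<open>f\<close> in \<open>F\<close>, and the cone of \<open>r\<close> at
  \<open>f\<close> lies below \<open>q f\<close>.\<close>

lemma Q_dense:
  assumes "r \<in> \<P> H" "r \<subseteq> Q"
  shows "\<exists>f\<in>F. \<exists>r'\<in>\<P> H. r' \<subseteq> r \<and> r' \<subseteq> q f"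
proof -
  have r: "pretree r" using assms(1) by (simp add: conditions_iff)
  obtain f where f: "f \<in> Lev n r" using pretree_Lev[OF r] by blast
  then have "f \<in> Lev n Q" using assms(2) unfolding Lev_def by blast
  then have fF: "f \<in> F" unfolding Lev_Q .
  have "cone r f \<in> \<P> H" using cone_condition assms(1) f by (simp add: Lev_def)
  moreover have "cone r f \<subseteq> q f"
  proof
    fix g assume g: "g \<in> cone r f"
    show "g \<in> q f"
    proof (cases "prefix g f")
      case True
      then show ?thesis using pretree_prefix[OF q_pretree[OF fF] stem[OF fF]] by blast
    next
      case False
      then have fg: "prefix f g" using g by (simp add: cone_def)
      then have ng: "n \<le> length g" using F(3)[OF fF] prefix_length_le by blast
      have "g \<in> Q" using g assms(2) cone_subset by blast
      then obtain f' where f': "f' \<in> F" "g \<in> q f'" by blast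
      then have "prefix f' g" using stem_prefix ng by blast
      then have "f' = f" using fg F(3)[OF fF] F(3)[OF f'(1)] by (auto simp: prefix_def append_eq_append_conv)
      then show ?thesis using f' by simp
    qed
  qed
  moreover have "cone r f \<subseteq> r" by (rule cone_subset)
  ultimately show ?thesis using fF by meson
qed

end

text \<open>Abstracts the set of conditions forcing a fixed sentence, so that the fusion arguments
  need not mention names.\<close>

definition regular_open :: "'a set set \<Rightarrow> ('a set \<Rightarrow> bool) \<Rightarrow> bool" where
  "regular_open P \<Phi> \<longleftrightarrow>
     (\<forall>p\<in>P. \<forall>q\<in>P. q \<subseteq> p \<longrightarrow> \<Phi> p \<longrightarrow> \<Phi> q) \<and>
     (\<forall>p\<in>P. (\<forall>q\<in>P. q \<subseteq> p \<longrightarrow> (\<exists>r\<in>P. r \<subseteq> q \<and> \<Phi> r)) \<longrightarrow> \<Phi> p)"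

lemma (in amalgamation) Q_regular_open:
  assumes "regular_open (\<P> H) \<Phi>" "\<And>f. f \<in> F \<Longrightarrow> \<Phi> (q f)"
  shows "\<Phi> Q"
proof -
  have "\<exists>r'\<in>\<P> H. r' \<subseteq> r \<and> \<Phi> r'" if r: "r \<in> \<P> H" "r \<subseteq> Q" for r
  proof -
    obtain f r' where "f \<in> F" "r' \<in> \<P> H" "r' \<subseteq> r" "r' \<subseteq> q f" using Q_dense[OF r] by blast
    then show ?thesis using assms q(1) unfolding regular_open_def by meson
  qed
  then show ?thesis using assms(1) Q_condition unfolding regular_open_def by meson
qed

section \<open>Level amalgamation and limits of fusion sequences\<close>

context stable_ordered_union
begin

text \<open>The set \<open>S\<close> will be a singleton for a move that must keep a block big, and
  empty for a move that only forces something.\<close>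

lemma amalgamate_level:
  assumes p: "p \<in> \<P> H" and reg: "regular_open (\<P> H) \<Phi>"
    and ex: "\<And>f. f \<in> Lev n p \<Longrightarrow> \<exists>q\<in>\<P> H. q \<subseteq> cone p f \<and> \<Phi> q \<and> S \<subseteq> big_set q k"
    and S: "S \<subseteq> {s \<in> FIN. n \<le> Max s}"
  shows "\<exists>q\<in>\<P> H. q \<subseteq> p \<and> Lev n q = Lev n p \<and> \<Phi> q \<and> S \<subseteq> big_set q k"
proof -
  have pp: "pretree p" using p by (simp add: conditions_iff)
  obtain q where qp: "\<And>f. f \<in> Lev n p \<Longrightarrow> q f \<in> \<P> H \<and> q f \<subseteq> cone p f \<and> \<Phi> (q f) \<and> S \<subseteq> big_set (q f) k"
    using ex by metis
  interpret amalgamation H "Lev n p" n q p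
    using qp finite_Lev[OF pp] pretree_Lev[OF pp] by unfold_locales (auto simp: Lev_def)
  have "q f \<subseteq> p" if "f \<in> Lev n p" for f using qp[OF that] cone_subset[of p f] by (meson order_trans)
  then have "Q \<subseteq> p" by (rule UN_least)
  moreover have "\<Phi> Q" by (rule Q_regular_open[OF reg]) (simp add: qp)
  moreover have "S \<subseteq> big_set Q k"
  proof
    fix s assume s: "s \<in> S"
    show "s \<in> big_set Q k"
    proof (rule big_set_Q)
      fix f assume "f \<in> Lev n p"
      then show "s \<in> big_set (q f) k" using qp s by (meson subsetD)
    qed (use S s in auto)
  qed
  ultimately show ?thesis using Q_condition Lev_Q by (intro bexI[of _ Q] conjI)
qed

text \<open>Freezing a level freezes the lower ones, which consist of restrictions of its nodes. So
  every level of the limit is already present at a finite stage.\<close>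

lemma fusion:
  assumes p: "\<And>n. p n \<in> \<P> H" "\<And>n. p (Suc n) \<subseteq> p n"
    and Lev: "\<And>n. Lev (N n) (p (Suc n)) = Lev (N n) (p n)"
    and N: "\<And>n. N n \<le> N (Suc n)" "\<And>m. \<exists>n. m \<le> N n"
  shows "pretree (\<Inter>n. p n)" and "m \<le> N n \<Longrightarrow> Lev m (\<Inter>n. p n) = Lev m (p n)"
proof -
  let ?q = "\<Inter>n. p n"
  have pp: "pretree (p n)" for n using p(1) by (simp add: conditions_iff)
  have N_mono: "N i \<le> N j" if "i \<le> j" for i j using lift_Suc_mono_le[of N] N(1) that by blast
  have p_anti: "p j \<subseteq> p i" if "i \<le> j" for i j using lift_Suc_antimono_le[of p] p(2) that by blast
  have Lev_le: "Lev m (p i) = Lev m (p n)" if "m \<le> N n" "n \<le> i" for m n i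
    using \<open>n \<le> i\<close>
  proof (induction i rule: dec_induct)
    case (step i)
    have "m \<le> N i" using that(1) N_mono[OF step(1)] by simp
    then have "Lev m (p (Suc i)) = Lev m (p i)"
      using pretree_Lev_take[OF pp] Lev by metis
    then show ?case using step by simp
  qed simp
  have Lev_q: "Lev m ?q = Lev m (p n)" if m: "m \<le> N n" for m n
  proof
    show "Lev m ?q \<subseteq> Lev m (p n)" by (auto simp: Lev_def)
    show "Lev m (p n) \<subseteq> Lev m ?q"
    proof
      fix f assume f: "f \<in> Lev m (p n)"
      have "f \<in> p i" for i
        using f Lev_le[OF m, of i] p_anti[of i n] by (cases "n \<le> i") (auto simp: Lev_def)
      then show "f \<in> Lev m ?q" using f by (simp add: Lev_def)
    qed
  qed
  then show "m \<le> N n \<Longrightarrow> Lev m ?q = Lev m (p n)" .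
  show "pretree ?q"
    unfolding pretree_def
  proof (intro conjI ballI allI impI)
    show "subtree ?q"
      unfolding subtree_def
    proof (intro conjI ballI allI impI)
      show "?q \<subseteq> \<T>" using pp[of 0] by (auto simp: pretree_def subtree_def)
      fix f g assume "f \<in> ?q" "prefix g f"
      then show "g \<in> ?q" using pretree_prefix[OF pp] by blast
    qed
    show "[] \<in> ?q" using pp by (simp add: pretree_def)
    fix f m assume f: "f \<in> ?q" "length f \<le> m"
    obtain n where n: "m \<le> N n" using N(2) by blast
    obtain g where "g \<in> Lev m (p n)" "prefix f g"
      using pretree_extend[OF pp[of n] _ f(2)] f(1) by blast
    then show "\<exists>g\<in>?q. prefix f g \<and> m \<le> length g"
      using Lev_q[OF n] by (intro bexI[of _ g]) (auto simp: Lev_def)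
  qed
qed

lemma big_set_in_H:
  assumes X: "X \<in> FIN\<^sup>\<omega>" "Y \<subseteq> X" and HY: "{u \<in> \<langle>X\<rangle>. \<exists>y\<in>Y. Max y = Max u} \<in> H"
    and big: "\<And>t y. t \<in> X \<Longrightarrow> y \<in> Y \<Longrightarrow> t <\<^sub>b y \<Longrightarrow> y \<in> big_set q (Suc (Max t))"
  shows "big_set q k \<in> H"
proof -
  have bX: "block_sequence X" "X \<subseteq> FIN" using X(1) by (auto simp: inf_block_sequences_def block_sequence_def)
  \<comment> \<open>Unions that start after \<open>t0\<close> have minimum above \<open>k\<close>,
    and even a union consisting of a single block then has a predecessor in \<open>X\<close> to
    which the hypothesis \<open>big\<close> applies.\<close>
  obtain t0 where t0: "t0 \<in> X" "k < Min t0" using inf_block_sequence_unbounded[OF X(1)] by blast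
  have kt0: "k < Max t0" using FIN_D[of t0] t0 bX by fastforce
  have "u \<in> big_set q k" if u: "u \<in> \<langle>X\<rangle>" "\<exists>y\<in>Y. Max y = Max u" "Max t0 < Min u" for u
  proof -
    obtain x where x: "x \<in> X" "Max x = Max u" "u = x \<or> (\<exists>t\<in>\<langle>X\<rangle>. t <\<^sub>b x \<and> u = t \<union> x)"
      using finite_unions_last[OF bX(1) u(1)] by blast
    have xY: "x \<in> Y" using u(2) x(1,2) X(2) block_sequence_Max_inj[OF bX(1)] by (metis inj_onD subsetD)
    from x(3) show ?thesis
    proof
      assume "u = x"
      then have "x \<in> big_set q (Suc (Max t0))" using big[OF t0(1) xY] u(3) by (simp add: block_less_def)
      then show ?thesis using big_set_antimono[of k "Suc (Max t0)"] kt0 \<open>u = x\<close> by auto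
    next
      assume "\<exists>t\<in>\<langle>X\<rangle>. t <\<^sub>b x \<and> u = t \<union> x"
      then obtain t where t: "t \<in> \<langle>X\<rangle>" "t <\<^sub>b x" "u = t \<union> x" by blast
      have tF: "t \<in> FIN" "u \<in> FIN" using t(1) u(1) finite_unions_subset_FIN by blast+
      obtain y where y: "y \<in> X" "Max y = Max t" using finite_unions_Max[OF bX(1) t(1)] by blast
      have "x \<in> big_set q (Suc (Max t))" using big[OF y(1) xY] y(2) t(2) by (simp add: block_less_def)
      moreover have "k \<le> Min t"
      proof -
        have "Min t \<in> u" using FIN_D[OF tF(1)] t(3) by blast
        then have "Min u \<le> Min t" using FIN_D[OF tF(2)] by simp
        then show ?thesis using u(3) kt0 by simp
      qed
      ultimately show ?thesis using big_set_Un[OF _ tF(1) t(2)] t(3) by simp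
    qed
  qed
  then have "{u \<in> \<langle>X\<rangle>. \<exists>y\<in>Y. Max y = Max u} \<inter> {s \<in> FIN. Max t0 < Min s} \<subseteq> big_set q k" by blast
  with H_Int[OF HY tail] show ?thesis by (rule H_superset) (auto simp: big_set_def)
qed

end

section \<open>Fusion games\<close>

text \<open>
  A state \<open>(p, N)\<close> consists of a condition whose levels up to \<open>N\<close> are frozen. At time \<open>\<tau> e\<close> the
  move \<open>e\<close> may be played; only finitely many states are reachable before a given time, which is
  why countably many diagonalizations suffice to make a sequence of moves legal in advance.
\<close>

locale fusion_game = stable_ordered_union +
  fixes R :: "node set \<Rightarrow> nat \<Rightarrow> 'e \<Rightarrow> node set \<Rightarrow> bool" and W :: "'e set" and \<tau> :: "'e \<Rightarrow> nat"
    and p0 :: "node set"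
  assumes p0: "p0 \<in> \<P> H"
    and R: "R p N e p' \<Longrightarrow> p \<in> \<P> H \<Longrightarrow> p' \<in> \<P> H \<and> p' \<subseteq> p \<and> Lev N p' = Lev N p"
    and finite_moves: "finite {e \<in> W. \<tau> e = n}"
begin

text \<open>The choice of one outcome makes the state a function of the moves played, which keeps
  \<open>reach n\<close> finite. The new frozen level is \<open>Suc (\<tau> e)\<close>, since the
  bigness of a block ending at \<open>\<tau> e\<close> depends on this level too.\<close>

definition move :: "node set \<times> nat \<Rightarrow> 'e \<Rightarrow> node set \<times> nat" where
  "move \<sigma> e = (if \<exists>p'. R (fst \<sigma>) (snd \<sigma>) e p'
     then (SOME p'. R (fst \<sigma>) (snd \<sigma>) e p', Suc (\<tau> e)) else \<sigma>)"

primrec reach :: "nat \<Rightarrow> (node set \<times> nat) set" where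
  "reach 0 = {(p0, 0)}"
| "reach (Suc n) = reach n \<union> (\<Union>e\<in>{e \<in> W. \<tau> e = n}. (\<lambda>\<sigma>. move \<sigma> e) ` reach n)"

lemma move:
  assumes "R (fst \<sigma>) (snd \<sigma>) e p'"
  shows "R (fst \<sigma>) (snd \<sigma>) e (fst (move \<sigma> e))" "snd (move \<sigma> e) = Suc (\<tau> e)"
  using someI[of "R (fst \<sigma>) (snd \<sigma>) e", OF assms] assms by (auto simp: move_def)

lemma finite_reach: "finite (reach n)"
  by (induction n) (use finite_moves in auto)

lemma reach_mono: "m \<le> n \<Longrightarrow> reach m \<subseteq> reach n"
  by (rule lift_Suc_mono_le[of reach]) auto

lemma reach_state: "\<sigma> \<in> reach n \<Longrightarrow> fst \<sigma> \<in> \<P> H \<and> fst \<sigma> \<subseteq> p0 \<and> snd \<sigma> \<le> n"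
proof (induction n arbitrary: \<sigma>)
  case (Suc n)
  from Suc.prems consider "\<sigma> \<in> reach n" | \<rho> e where "\<rho> \<in> reach n" "\<tau> e = n" "\<sigma> = move \<rho> e" by auto
  then show ?case
  proof cases
    case 1
    then show ?thesis using Suc.IH by fastforce
  next
    case 2
    show ?thesis
    proof (cases "\<exists>p'. R (fst \<rho>) (snd \<rho>) e p'")
      case True
      then obtain p' where p': "R (fst \<rho>) (snd \<rho>) e p'" by blast
      show ?thesis using R[OF move(1)[OF p']] move(2)[OF p'] Suc.IH[OF 2(1)] 2(2,3) by auto
    next
      case False
      then have "\<sigma> = \<rho>" using 2(3) by (simp add: move_def)
      then show ?thesis using Suc.IH[OF 2(1)] by simp
    qed
  qed
qed (use p0 in simp)

text \<open>The state does not change between moves, so at time \<open>\<tau> e\<close> it already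
  lies in \<open>reach l\<close>, where \<open>l\<close> is \<open>0\<close> or the time just after
  the previous move. Legality is therefore required only at such \<open>l\<close>. Bigness of the
  limit stays a premise because it depends on the particular moves.\<close>

lemma play:
  assumes E: "E \<subseteq> W" "inj_on \<tau> E" "\<And>n. \<exists>e\<in>E. n \<le> \<tau> e"
    and legal: "\<And>e l \<sigma>. e \<in> E \<Longrightarrow> l \<le> \<tau> e \<Longrightarrow> l = 0 \<or> (\<exists>e'\<in>E. l = Suc (\<tau> e')) \<Longrightarrow> \<sigma> \<in> reach l \<Longrightarrow>
      \<exists>p'. R (fst \<sigma>) (snd \<sigma>) e p'"
  obtains q where "q \<subseteq> p0" "(\<forall>k. big_set q k \<in> H) \<longrightarrow> q \<in> \<P> H"
    and "\<forall>e\<in>E. \<exists>l \<sigma> p'. l \<le> \<tau> e \<and> (l = 0 \<or> (\<exists>e'\<in>E. l = Suc (\<tau> e'))) \<and> \<sigma> \<in> reach l \<and>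
      (\<forall>e'\<in>E. \<tau> e' < \<tau> e \<longrightarrow> \<tau> e' < snd \<sigma>) \<and> R (fst \<sigma>) (snd \<sigma>) e p' \<and> p' \<in> \<P> H \<and> q \<subseteq> p' \<and>
      (\<forall>m\<le>Suc (\<tau> e). Lev m q = Lev m p')"
proof -
  define next_state where "next_state n \<sigma> =
    (if \<exists>e\<in>E. \<tau> e = n then move \<sigma> (THE e. e \<in> E \<and> \<tau> e = n) else \<sigma>)" for n \<sigma>
  define s where "s = rec_nat (p0, 0) next_state"
  have s0: "s 0 = (p0, 0)" and s_Suc: "s (Suc n) = next_state n (s n)" for n by (simp_all add: s_def)
  have s_move: "s (Suc (\<tau> e)) = move (s (\<tau> e)) e" if "e \<in> E" for e
  proof -
    have "(THE e'. e' \<in> E \<and> \<tau> e' = \<tau> e) = e"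
      by (rule the_equality) (use that E(2) in \<open>auto simp: inj_on_def\<close>)
    then show ?thesis using that by (auto simp: s_Suc next_state_def)
  qed
  have s_stay: "s (Suc n) = s n" if "\<not> (\<exists>e\<in>E. \<tau> e = n)" for n
    using that by (simp add: s_Suc next_state_def)
  have s_reach: "\<exists>l\<le>n. (l = 0 \<or> (\<exists>e\<in>E. l = Suc (\<tau> e))) \<and> s n \<in> reach l" for n
  proof (induction n)
    case 0
    then show ?case by (simp add: s0)
  next
    case (Suc n)
    then obtain l where l: "l \<le> n" "l = 0 \<or> (\<exists>e\<in>E. l = Suc (\<tau> e))" "s n \<in> reach l" by blast
    show ?case
    proof (cases "\<exists>e\<in>E. \<tau> e = n")
      case True
      then obtain e where e: "e \<in> E" "\<tau> e = n" by blast
      have "s n \<in> reach n" using l reach_mono by blast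
      then have "s (Suc n) \<in> reach (Suc n)" using s_move[OF e(1)] e E(1) by auto
      then show ?thesis using e by blast
    next
      case False
      then show ?thesis using l s_stay[OF False] le_SucI by metis
    qed
  qed
  have s_cond: "fst (s n) \<in> \<P> H" "snd (s n) \<le> n" for n
    using s_reach[of n] reach_state le_trans by blast+
  have s_R: "R (fst (s (\<tau> e))) (snd (s (\<tau> e))) e (fst (s (Suc (\<tau> e))))"
    and s_frozen: "snd (s (Suc (\<tau> e))) = Suc (\<tau> e)" if e: "e \<in> E" for e
  proof -
    obtain l where "l \<le> \<tau> e" "l = 0 \<or> (\<exists>e'\<in>E. l = Suc (\<tau> e'))" "s (\<tau> e) \<in> reach l"
      using s_reach by blast
    then obtain p' where "R (fst (s (\<tau> e))) (snd (s (\<tau> e))) e p'" using legal[OF e] by blast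
    from move[OF this] show "R (fst (s (\<tau> e))) (snd (s (\<tau> e))) e (fst (s (Suc (\<tau> e))))"
      "snd (s (Suc (\<tau> e))) = Suc (\<tau> e)" by (simp_all add: s_move[OF e])
  qed
  define p N where "p n = fst (s n)" and "N n = snd (s n)" for n
  have step: "p (Suc n) \<subseteq> p n \<and> Lev (N n) (p (Suc n)) = Lev (N n) (p n) \<and> N n \<le> N (Suc n)" for n
  proof (cases "\<exists>e\<in>E. \<tau> e = n")
    case True
    then obtain e where e: "e \<in> E" "\<tau> e = n" by blast
    show ?thesis
      using R[OF s_R[OF e(1)] s_cond(1)] s_frozen[OF e(1)] s_cond(2)[of n] e(2)
      by (simp add: p_def N_def)
  next
    case False
    then show ?thesis using s_stay[OF False] by (simp add: p_def N_def)
  qed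
  have N_mono: "N i \<le> N j" if "i \<le> j" for i j by (rule lift_Suc_mono_le[OF _ that]) (simp add: step)
  have p_anti: "p j \<subseteq> p i" if "i \<le> j" for i j by (rule lift_Suc_antimono_le[OF _ that]) (simp add: step)
  have N_unbounded: "\<exists>n. m \<le> N n" for m
  proof -
    obtain e where "e \<in> E" "m \<le> \<tau> e" using E(3) by blast
    then have "m \<le> N (Suc (\<tau> e))" using s_frozen by (simp add: N_def)
    then show ?thesis by blast
  qed
  let ?q = "\<Inter>n. p n"
  have fus: "pretree ?q" "m \<le> N n \<Longrightarrow> Lev m ?q = Lev m (p n)" for m n
    using fusion[of p N, OF _ _ _ _ N_unbounded] step s_cond(1) by (auto simp: p_def)
  show ?thesis
  proof (rule that[of ?q])
    have "p 0 = p0" by (simp add: p_def s0)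
    then show "?q \<subseteq> p0" by blast
    show "(\<forall>k. big_set ?q k \<in> H) \<longrightarrow> ?q \<in> \<P> H" using fus(1) by (simp add: conditions_iff)
    show "\<forall>e\<in>E. \<exists>l \<sigma> p'. l \<le> \<tau> e \<and> (l = 0 \<or> (\<exists>e'\<in>E. l = Suc (\<tau> e'))) \<and> \<sigma> \<in> reach l \<and>
      (\<forall>e'\<in>E. \<tau> e' < \<tau> e \<longrightarrow> \<tau> e' < snd \<sigma>) \<and> R (fst \<sigma>) (snd \<sigma>) e p' \<and> p' \<in> \<P> H \<and> ?q \<subseteq> p' \<and>
      (\<forall>m\<le>Suc (\<tau> e). Lev m ?q = Lev m p')" (is "\<forall>e\<in>E. ?played e")
    proof
      fix e assume e: "e \<in> E"
      obtain l where l: "l \<le> \<tau> e" "l = 0 \<or> (\<exists>e'\<in>E. l = Suc (\<tau> e'))" "s (\<tau> e) \<in> reach l"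
        using s_reach by blast
      have "\<tau> e' < snd (s (\<tau> e))" if "e' \<in> E" "\<tau> e' < \<tau> e" for e'
        using N_mono[of "Suc (\<tau> e')" "\<tau> e"] s_frozen[OF that(1)] that(2) by (simp add: N_def)
      moreover have "Lev m ?q = Lev m (p (Suc (\<tau> e)))" if "m \<le> Suc (\<tau> e)" for m
        by (rule fus(2)) (use that s_frozen[OF e] in \<open>simp add: N_def\<close>)
      moreover have "?q \<subseteq> p (Suc (\<tau> e))" by blast
      ultimately show "?played e"
        using l s_R[OF e] s_cond(1)[of "Suc (\<tau> e)"]
        by (intro exI[of _ l] exI[of _ "s (\<tau> e)"] exI[of _ "p (Suc (\<tau> e))"]) (simp add: p_def)
    qed
  qed
qed

end

lemma inf_block_sequence_Max_unbounded:
  assumes "X \<in> FIN\<^sup>\<omega>"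
  shows "\<exists>x\<in>X. n < Max x"
proof -
  obtain x where x: "x \<in> X" "n < Min x" using inf_block_sequence_unbounded[OF assms] by blast
  then have "x \<in> FIN" using assms by (auto simp: inf_block_sequences_def block_sequence_def)
  from FIN_D[OF this] show ?thesis using x by (intro bexI[of _ x]) auto
qed

lemma finite_Max_eq: "finite {s \<in> FIN. Max s = n}"
proof (rule finite_subset)
  show "{s \<in> FIN. Max s = n} \<subseteq> Pow {..n}" by (auto simp: FIN_def)
qed simp

context stable_ordered_union
begin

section \<open>Ultrafilters that are images of \<open>max(H)\<close>\<close>

definition good :: "(nat \<Rightarrow> nat) \<Rightarrow> (nat \<Rightarrow> node set \<Rightarrow> bool) \<Rightarrow> node set \<Rightarrow> nat \<Rightarrow> nat set set" where
  "good \<psi> \<Phi> r k = {s \<in> FIN. \<exists>q\<in>\<P> H. q \<subseteq> r \<and> s \<in> big_set q k \<and> \<Phi> (\<psi> (Max s)) q}"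

lemma good_mono: "r \<subseteq> r' \<Longrightarrow> k' \<le> k \<Longrightarrow> good \<psi> \<Phi> r k \<subseteq> good \<psi> \<Phi> r' k'"
  using big_set_antimono[of k' k] unfolding good_def by (auto; meson order_trans subsetD)

text \<open>
  If no condition below \<open>r\<close> forces \<open>\<psi> (Max s)\<close> in while keeping \<open>s\<close> big, then it can be forced
  out while keeping \<open>t \<union> s\<close> big, and \<open>Max (t \<union> s) = Max s\<close>.
\<close>

lemma good_dichotomy:
  assumes reg: "\<And>n. regular_open (\<P> H) (\<Phi> n)" "\<And>n. regular_open (\<P> H) (\<Psi> n)"
    and dec: "\<And>n p. p \<in> \<P> H \<Longrightarrow> \<exists>q\<in>\<P> H. q \<subseteq> p \<and> (\<Phi> n q \<or> \<Psi> n q)"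
    and r: "r \<in> \<P> H"
  shows "good \<psi> \<Phi> r k \<in> H \<or> good \<psi> \<Psi> r k \<in> H"
proof (cases "good \<psi> \<Phi> r k \<in> H")
  case False
  have rp: "pretree r" using r by (simp add: conditions_iff)
  \<comment> \<open>Keep only the successors in \<open>B\<close> of the single node
    \<open>f\<close>, with \<open>q \<tau>\<close> above each of them. The amalgam has no node but
    \<open>f\<close> at level \<open>Max u\<close>, and there its successor set is the big set
    \<open>B\<close>.\<close>
  have combine: "u \<in> good \<psi> \<Xi> r k"
    if f: "f \<in> Lev (Max u) r" and B: "B \<subseteq> succs r f" "big k u B" and u: "u \<in> FIN" "k \<le> Max u"
      and reg: "regular_open (\<P> H) (\<Xi> (\<psi> (Max u)))"
      and qB: "\<And>\<tau>. \<tau> \<in> B \<Longrightarrow> q \<tau> \<in> \<P> H \<and> q \<tau> \<subseteq> cone r (f @ [\<tau>]) \<and> \<Xi> (\<psi> (Max u)) (q \<tau>)"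
    for u f B q and \<Xi> :: "nat \<Rightarrow> node set \<Rightarrow> bool"
  proof -
    let ?F = "(\<lambda>\<tau>. f @ [\<tau>]) ` B"
    have len: "length f = Max u" using f by (simp add: Lev_def)
    have "?F \<subseteq> Lev (Suc (Max u)) r" using B(1) len by (auto simp: succs_def Lev_def)
    then have "finite ?F" using finite_Lev[OF rp] finite_subset by blast
    moreover have "B \<noteq> {}" using B(2) by (auto simp: big_iff)
    moreover have "q (last g) \<in> \<P> H" "q (last g) \<subseteq> cone r g" if "g \<in> ?F" for g
      using that qB by fastforce+
    ultimately interpret amalgamation H ?F "Suc (Max u)" "\<lambda>g. q (last g)" r
      by unfold_locales (use len in \<open>auto simp: image_iff\<close>)
    have Lev: "Lev (Suc (Max u)) Q = ?F" by (rule Lev_Q)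
    have "Lev (Max u) Q = take (Max u) ` ?F"
      using pretree_Lev_take[of Q "Max u" "Suc (Max u)"] Q_condition Lev by (simp add: conditions_iff)
    then have "Lev (Max u) Q \<subseteq> {f}" using len by auto
    moreover have "succs Q f = B"
    proof -
      have "f @ [\<tau>] \<in> Q \<longleftrightarrow> f @ [\<tau>] \<in> Lev (Suc (Max u)) Q" for \<tau> by (simp add: Lev_def len)
      then show ?thesis unfolding Lev succs_def by auto
    qed
    ultimately have "u \<in> big_set Q k" using B(2) u by (auto simp: big_set_def)
    moreover have "\<Xi> (\<psi> (Max u)) Q" using qB by (intro Q_regular_open[OF reg]) auto
    moreover have "Q \<subseteq> r"
    proof (rule UN_least)
      fix g assume "g \<in> ?F"
      then show "q (last g) \<subseteq> r" using qB cone_subset by fastforce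
    qed
    ultimately show ?thesis unfolding good_def using u(1) Q_condition by blast
  qed
  have "good \<psi> \<Psi> r k \<in> H"
  proof (rule shift_in_H)
    show "good \<psi> \<Psi> r k \<subseteq> FIN" by (auto simp: good_def)
    fix t assume t: "t \<in> FIN" "k < Min t"
    have "t \<union> s \<in> good \<psi> \<Psi> r k"
      if s: "s \<in> FIN" "s \<notin> good \<psi> \<Phi> r k" "s \<in> big_set r (Suc (Max t))" "Max t < Min s" for s
    proof -
      have ts: "t <\<^sub>b s" using s(4) by (simp add: block_less_def)
      have k: "k \<le> Max s" using FIN_D[OF t(1)] FIN_D[OF s(1)] t s(4) by linarith
      obtain f where f: "f \<in> Lev (Max s) r" using pretree_Lev[OF rp] by blast
      have "\<exists>q\<in>\<P> H. q \<subseteq> cone r (f @ [\<tau>]) \<and> (\<Phi> (\<psi> (Max s)) q \<or> \<Psi> (\<psi> (Max s)) q)"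
        if "\<tau> \<in> succs r f" for \<tau>
        using dec[OF cone_condition[OF r, of "f @ [\<tau>]"]] that by (simp add: succs_def)
      then obtain q where q: "\<And>\<tau>. \<tau> \<in> succs r f \<Longrightarrow> q \<tau> \<in> \<P> H \<and> q \<tau> \<subseteq> cone r (f @ [\<tau>]) \<and>
          (\<Phi> (\<psi> (Max s)) (q \<tau>) \<or> \<Psi> (\<psi> (Max s)) (q \<tau>))" by metis
      \<comment> \<open>The colours record what the chosen \<open>q \<tau>\<close> decides. They may
        overlap, since \<open>big_partition\<close> asks only for a covering.\<close>
      let ?A = "\<lambda>\<Xi>. {\<tau> \<in> succs r f. \<Xi> (\<psi> (Max s)) (q \<tau>)}"
      have "big (Suc (Max t)) s (succs r f)" using s(3) f by (simp add: big_set_def)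
      moreover have "succs r f \<subseteq> ?A \<Phi> \<union> ?A \<Psi>" using q by blast
      ultimately have "big k s (?A \<Phi>) \<or> big k (t \<union> s) (?A \<Psi>)"
        using t(2) by (intro big_partition[OF _ _ s(1) t(1) ts]) auto
      moreover have "\<not> big k s (?A \<Phi>)"
      proof
        assume "big k s (?A \<Phi>)"
        then have "s \<in> good \<psi> \<Phi> r k"
          by (intro combine[of f s "?A \<Phi>" \<Phi> q]) (use f q k s(1) reg in auto)
        then show False using s(2) by simp
      qed
      ultimately have big: "big k (t \<union> s) (?A \<Psi>)" by blast
      have M: "Max (t \<union> s) = Max s" by (rule Max_Un_block[OF t(1) s(1) ts])
      show ?thesis
        by (rule combine[of f "t \<union> s" "?A \<Psi>" \<Psi> q]) (use f q M big k FIN_Un[OF t(1) s(1)] reg in auto)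
    qed
    then have sub: "((FIN - good \<psi> \<Phi> r k) \<inter> big_set r (Suc (Max t))) \<inter> {s \<in> FIN. Max t < Min s}
      \<subseteq> {s \<in> FIN. t \<union> s \<in> good \<psi> \<Psi> r k}" by blast
    have "FIN - good \<psi> \<Phi> r k \<in> H" using False by (intro H_compl) (auto simp: good_def)
    moreover have "big_set r (Suc (Max t)) \<in> H" using r by (simp add: conditions_iff)
    ultimately have "((FIN - good \<psi> \<Phi> r k) \<inter> big_set r (Suc (Max t))) \<inter> {s \<in> FIN. Max t < Min s} \<in> H"
      by (intro H_Int tail)
    from H_superset[OF this sub] show "{s \<in> FIN. t \<union> s \<in> good \<psi> \<Psi> r k} \<in> H" by blast
  qed
  then show ?thesis by blast
qed blast

lemma image_of_max_fusion:
  assumes U: "ultrafilter_on UNIV U" and \<psi>: "\<And>B. B \<in> U \<Longrightarrow> {s \<in> FIN. \<psi> (Max s) \<in> B} \<in> H"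
    and reg: "\<And>n. regular_open (\<P> H) (\<Phi> n)"
    and p0: "p0 \<in> \<P> H" and good: "\<And>r k. r \<in> \<P> H \<Longrightarrow> r \<subseteq> p0 \<Longrightarrow> good \<psi> \<Phi> r k \<in> H"
  shows "\<exists>q\<in>\<P> H. q \<subseteq> p0 \<and> (\<exists>B\<in>U. \<forall>n\<in>B. \<Phi> n q)"
proof -
  define R where "R p N s p' \<longleftrightarrow> p' \<in> \<P> H \<and> p' \<subseteq> p \<and> Lev N p' = Lev N p \<and>
    \<Phi> (\<psi> (Max s)) p' \<and> {s} \<subseteq> big_set p' N" for p N s p'
  interpret fusion_game H R FIN Max p0
    by unfold_locales (auto simp: R_def p0 finite_Max_eq)
  define D where "D n = {s \<in> FIN. \<forall>\<sigma>\<in>reach n. \<exists>p'. R (fst \<sigma>) (snd \<sigma>) s p'}" for n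
  have "D n \<in> H" for n
    unfolding D_def
  proof (rule H_finite_INT[OF finite_reach])
    fix \<sigma> assume "\<sigma> \<in> reach n"
    then have \<sigma>: "fst \<sigma> \<in> \<P> H" "fst \<sigma> \<subseteq> p0" using reach_state by blast+
    let ?p = "fst \<sigma>" and ?N = "snd \<sigma>"
    have pp: "pretree ?p" using \<sigma>(1) by (simp add: conditions_iff)
    have "good \<psi> \<Phi> (cone ?p f) ?N \<in> H" if "f \<in> Lev ?N ?p" for f
    proof (rule good)
      show "cone ?p f \<in> \<P> H" using cone_condition[OF \<sigma>(1)] that by (simp add: Lev_def)
      show "cone ?p f \<subseteq> p0" using cone_subset \<sigma>(2) by blast
    qed
    then have "{s \<in> FIN. s \<in> good \<psi> \<Phi> (cone ?p f) ?N} \<in> H" if "f \<in> Lev ?N ?p" for f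
      using that by (simp add: good_def)
    from H_Int[OF H_finite_INT[OF finite_Lev[OF pp] this] tail_Max[of ?N]]
    show "{s \<in> FIN. \<exists>p'. R ?p ?N s p'} \<in> H"
    proof (rule H_superset)
      show "{s \<in> FIN. \<forall>f\<in>Lev ?N ?p. s \<in> good \<psi> \<Phi> (cone ?p f) ?N} \<inter> {s \<in> FIN. ?N < Max s}
          \<subseteq> {s \<in> FIN. \<exists>p'. R ?p ?N s p'}"
      proof clarify
        fix s assume s: "s \<in> FIN" "\<forall>f\<in>Lev ?N ?p. s \<in> good \<psi> \<Phi> (cone ?p f) ?N" "?N < Max s"
        have "\<exists>q\<in>\<P> H. q \<subseteq> cone ?p f \<and> \<Phi> (\<psi> (Max s)) q \<and> {s} \<subseteq> big_set q ?N"
          if "f \<in> Lev ?N ?p" for f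
          using bspec[OF s(2) that] by (auto simp: good_def)
        then have "\<exists>q\<in>\<P> H. q \<subseteq> ?p \<and> Lev ?N q = Lev ?N ?p \<and> \<Phi> (\<psi> (Max s)) q \<and> {s} \<subseteq> big_set q ?N"
          by (rule amalgamate_level[OF \<sigma>(1) reg]) (use s(1,3) in auto)
        then show "\<exists>p'. R ?p ?N s p'" by (auto simp: R_def)
      qed
    qed auto
  qed
  from diagonal[of D, OF this] obtain X where X: "X \<in> FIN\<^sup>\<omega>" "\<langle>X\<rangle> \<in> H" "\<langle>X\<rangle> \<subseteq> D 0"
    "\<forall>s\<in>\<langle>X\<rangle>. \<forall>t\<in>\<langle>X\<rangle>. s <\<^sub>b t \<longrightarrow> t \<in> D (Suc (Max s))" by blast
  have bX: "block_sequence X" "X \<subseteq> FIN" using X(1) by (auto simp: inf_block_sequences_def block_sequence_def)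
  have XX: "X \<subseteq> \<langle>X\<rangle>" using subset_finite_unions[OF bX(2)] .
  obtain q where q: "q \<subseteq> p0" "(\<forall>k. big_set q k \<in> H) \<longrightarrow> q \<in> \<P> H"
    and qx: "\<forall>x\<in>X. \<exists>l \<sigma> p'. l \<le> Max x \<and> (l = 0 \<or> (\<exists>x'\<in>X. l = Suc (Max x'))) \<and> \<sigma> \<in> reach l \<and>
      (\<forall>x'\<in>X. Max x' < Max x \<longrightarrow> Max x' < snd \<sigma>) \<and> R (fst \<sigma>) (snd \<sigma>) x p' \<and> p' \<in> \<P> H \<and> q \<subseteq> p' \<and>
      (\<forall>m\<le>Suc (Max x). Lev m q = Lev m p')"
  proof (rule play[of X])
    show "inj_on Max X" using block_sequence_Max_inj[OF bX(1)] .
    show "\<exists>x\<in>X. n \<le> Max x" for n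
      using inf_block_sequence_Max_unbounded[OF X(1)] less_imp_le by blast
    fix x l \<sigma>
    assume x: "x \<in> X" "l \<le> Max x" "l = 0 \<or> (\<exists>x'\<in>X. l = Suc (Max x'))" "\<sigma> \<in> reach l"
    have "x \<in> D l"
      using x(3)
    proof
      assume "\<exists>x'\<in>X. l = Suc (Max x')"
      then obtain x' where x': "x' \<in> X" "l = Suc (Max x')" by blast
      then have "x' <\<^sub>b x" using block_sequence_Max_less[OF bX(1) x'(1) x(1)] x(2) by simp
      then show ?thesis using X(4) XX x' x(1) by blast
    qed (use X(3) XX x(1) in auto)
    then show "\<exists>p'. R (fst \<sigma>) (snd \<sigma>) x p'" using x(4) by (auto simp: D_def)
  qed (use bX in blast, rule that)
  have "big_set q k \<in> H" for k
  proof (rule big_set_in_H[OF X(1) order_refl])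
    have "{u \<in> \<langle>X\<rangle>. \<exists>y\<in>X. Max y = Max u} = \<langle>X\<rangle>" using finite_unions_Max[OF bX(1)] by blast
    then show "{u \<in> \<langle>X\<rangle>. \<exists>y\<in>X. Max y = Max u} \<in> H" using X(2) by simp
    fix t x assume tx: "t \<in> X" "x \<in> X" "t <\<^sub>b x"
    obtain \<sigma> p' where \<sigma>: "\<forall>x'\<in>X. Max x' < Max x \<longrightarrow> Max x' < snd \<sigma>" "R (fst \<sigma>) (snd \<sigma>) x p'"
      "\<forall>m\<le>Suc (Max x). Lev m q = Lev m p'" using bspec[OF qx tx(2)] by blast
    have "Max t < Max x" using block_less_Max[OF tx(3)] tx(2) bX(2) by blast
    then have "Suc (Max t) \<le> snd \<sigma>" using \<sigma>(1) tx(1) by (simp add: Suc_leI)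
    moreover have "x \<in> big_set p' (snd \<sigma>)" using \<sigma>(2) by (simp add: R_def)
    ultimately have "x \<in> big_set p' (Suc (Max t))" using big_set_antimono by blast
    then show "x \<in> big_set q (Suc (Max t))" using big_set_cong[of x q p'] \<sigma>(3) by simp
  qed
  then have qP: "q \<in> \<P> H" using q(2) by simp
  \<comment> \<open>Single blocks already yield a set in \<open>U\<close>: every union in
    \<open>\<langle>X\<rangle>\<close> has the maximum of one of its blocks, so the \<psi>-preimage
    of the complement of \<open>?B\<close> misses \<open>\<langle>X\<rangle>\<close>.\<close>
  let ?B = "(\<lambda>x. \<psi> (Max x)) ` X"
  have "?B \<in> U"
  proof (rule ccontr)
    assume "?B \<notin> U"
    then have "UNIV - ?B \<in> U" by (intro ultrafilter_compl[OF U]) auto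
    from H_nonempty[OF H_Int[OF \<psi>[OF this] X(2)]] obtain u where "u \<in> \<langle>X\<rangle>" "\<psi> (Max u) \<notin> ?B" by blast
    then show False using finite_unions_Max[OF bX(1)] by (metis imageI)
  qed
  moreover have "\<Phi> n q" if n: "n \<in> ?B" for n
  proof -
    obtain x where x: "x \<in> X" "n = \<psi> (Max x)" using n by blast
    obtain \<sigma> p' where "R (fst \<sigma>) (snd \<sigma>) x p'" "p' \<in> \<P> H" "q \<subseteq> p'" using bspec[OF qx x(1)] by blast
    then show ?thesis using reg[of n] qP x(2) unfolding regular_open_def R_def by meson
  qed
  ultimately show ?thesis using q(1) qP by blast
qed

section \<open>Ultrafilters that are not images of \<open>max(H)\<close>\<close>

text \<open>Blocks are diagonalized against blocks and numbers against numbers; what remains are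
  conflicts between the two kinds, recorded by \<open>near\<close>. Here \<open>not_image\<close>
  permits discarding the conflicting blocks.\<close>

lemma not_image_of_max_fusion:
  assumes U: "selective_ultrafilter U"
    and not_image: "\<And>\<psi>. \<exists>B\<in>U. {s \<in> FIN. \<psi> (Max s) \<in> B} \<notin> H"
    and reg: "\<And>n. regular_open (\<P> H) (\<Phi> n)"
    and p0: "p0 \<in> \<P> H"
    and large: "\<And>r. r \<in> \<P> H \<Longrightarrow> r \<subseteq> p0 \<Longrightarrow> {n. \<exists>q\<in>\<P> H. q \<subseteq> r \<and> \<Phi> n q} \<in> U"
  shows "\<exists>q\<in>\<P> H. q \<subseteq> p0 \<and> (\<exists>B\<in>U. \<forall>n\<in>B. \<Phi> n q)"
proof -
  have ufU: "ultrafilter_on UNIV U" using U by (simp add: selective_ultrafilter_def)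
  note U_Int = ultrafilter_Int[OF ufU] and U_finite_INT = ultrafilter_finite_INT[OF ufU]
  define R :: "node set \<Rightarrow> nat \<Rightarrow> nat set + nat \<Rightarrow> node set \<Rightarrow> bool" where
    "R p N e p' \<longleftrightarrow> (case e of Inl x \<Rightarrow> p' = p \<and> p \<in> \<P> H
      | Inr m \<Rightarrow> p' \<in> \<P> H \<and> p' \<subseteq> p \<and> Lev N p' = Lev N p \<and> \<Phi> m p')" for p N e p'
  define \<tau> :: "nat set + nat \<Rightarrow> nat" where "\<tau> e = (case e of Inl x \<Rightarrow> Max x | Inr m \<Rightarrow> m)" for e
  have fin_moves: "finite {e \<in> Inl ` FIN \<union> range Inr. \<tau> e = n}" for n
  proof (rule finite_subset)
    show "{e \<in> Inl ` FIN \<union> range Inr. \<tau> e = n} \<subseteq> Inl ` {s \<in> FIN. Max s = n} \<union> {Inr n}"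
      by (auto simp: \<tau>_def)
  qed (simp add: finite_Max_eq)
  interpret fusion_game H R "Inl ` FIN \<union> range Inr" \<tau> p0
  proof unfold_locales
    show "p0 \<in> \<P> H" by (rule p0)
    show "finite {e \<in> Inl ` FIN \<union> range Inr. \<tau> e = n}" for n by (rule fin_moves)
    show "R p N e p' \<Longrightarrow> p \<in> \<P> H \<Longrightarrow> p' \<in> \<P> H \<and> p' \<subseteq> p \<and> Lev N p' = Lev N p" for p N e p'
      by (simp add: R_def split: sum.splits)
  qed
  define D where "D n = {s \<in> FIN. \<forall>\<sigma>\<in>reach n. s \<in> big_set (fst \<sigma>) n}" for n
  define DU where "DU n = {m. \<forall>\<sigma>\<in>reach n. \<exists>p'. R (fst \<sigma>) (snd \<sigma>) (Inr m) p'}" for n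
  have D: "D n \<in> H" for n
    unfolding D_def
  proof (rule H_finite_INT[OF finite_reach])
    fix \<sigma> assume "\<sigma> \<in> reach n"
    then have "big_set (fst \<sigma>) n \<in> H" using reach_state by (auto simp: conditions_iff)
    moreover have "{s \<in> FIN. s \<in> big_set (fst \<sigma>) n} = big_set (fst \<sigma>) n" by (auto simp: big_set_def)
    ultimately show "{s \<in> FIN. s \<in> big_set (fst \<sigma>) n} \<in> H" by simp
  qed
  have DU: "DU n \<in> U" for n
  proof -
    have "{m \<in> UNIV. \<forall>\<sigma>\<in>reach n. \<exists>p'. R (fst \<sigma>) (snd \<sigma>) (Inr m) p'} \<in> U"
    proof (rule U_finite_INT[OF finite_reach])
      fix \<sigma> assume "\<sigma> \<in> reach n"
      then have \<sigma>: "fst \<sigma> \<in> \<P> H" "fst \<sigma> \<subseteq> p0" using reach_state by blast+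
      let ?p = "fst \<sigma>" and ?N = "snd \<sigma>"
      have pp: "pretree ?p" using \<sigma>(1) by (simp add: conditions_iff)
      have "{m \<in> UNIV. \<exists>q\<in>\<P> H. q \<subseteq> cone ?p f \<and> \<Phi> m q} \<in> U" if "f \<in> Lev ?N ?p" for f
      proof -
        have "cone ?p f \<in> \<P> H" using cone_condition[OF \<sigma>(1)] that by (simp add: Lev_def)
        moreover have "cone ?p f \<subseteq> p0" using cone_subset \<sigma>(2) by blast
        ultimately show ?thesis using large by simp
      qed
      from U_finite_INT[OF finite_Lev[OF pp] this]
      show "{m \<in> UNIV. \<exists>p'. R ?p ?N (Inr m) p'} \<in> U"
      proof (rule ultrafilter_superset[OF ufU])
        show "{m \<in> UNIV. \<forall>f\<in>Lev ?N ?p. \<exists>q\<in>\<P> H. q \<subseteq> cone ?p f \<and> \<Phi> m q}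
          \<subseteq> {m \<in> UNIV. \<exists>p'. R ?p ?N (Inr m) p'}"
        proof clarify
          fix m assume m: "\<forall>f\<in>Lev ?N ?p. \<exists>q\<in>\<P> H. q \<subseteq> cone ?p f \<and> \<Phi> m q"
          have "\<exists>q\<in>\<P> H. q \<subseteq> ?p \<and> Lev ?N q = Lev ?N ?p \<and> \<Phi> m q \<and> {} \<subseteq> big_set q 0"
            by (rule amalgamate_level[OF \<sigma>(1) reg]) (use m in auto)
          then show "\<exists>p'. R ?p ?N (Inr m) p'" by (auto simp: R_def)
        qed
      qed auto
    qed
    then show ?thesis by (simp add: DU_def)
  qed
  have D_antimono: "D n \<subseteq> D m" if "m \<le> n" for m n
    using reach_mono[OF that] big_set_antimono[OF that] unfolding D_def by blast
  obtain X where X: "X \<in> FIN\<^sup>\<omega>" "\<langle>X\<rangle> \<in> H" "\<langle>X\<rangle> \<subseteq> D 0"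
    "\<forall>s\<in>\<langle>X\<rangle>. \<forall>t\<in>\<langle>X\<rangle>. s <\<^sub>b t \<longrightarrow> t \<in> D (Suc (Max s))"
    using diagonal[of D, OF D] by blast
  have bX: "block_sequence X" "X \<subseteq> FIN" using X(1) by (auto simp: inf_block_sequences_def block_sequence_def)
  have XX: "X \<subseteq> \<langle>X\<rangle>" using subset_finite_unions[OF bX(2)] .
  \<comment> \<open>Neither order of play is known to be safe. The case \<open>m = Max x\<close>
    counts as near too, which later keeps the times of the moves distinct.\<close>
  define near where "near m x \<longleftrightarrow>
    \<not> (Max x < m \<and> m \<in> DU (Suc (Max x))) \<and> \<not> (m < Max x \<and> x \<in> D (Suc m))" for m x
  have near_finite: "finite {x \<in> X. near m x}" for m
  proof -
    \<comment> \<open>Blocks after \<open>t\<close> lie in \<open>D (Suc (Max t))\<close>, hence in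
      \<open>D (Suc m)\<close>, so they can be played after \<open>m\<close>.\<close>
    obtain t where t: "t \<in> X" "m < Max t" using inf_block_sequence_Max_unbounded[OF X(1)] by blast
    have "x = t \<or> x <\<^sub>b t" if x: "x \<in> X" "near m x" for x
    proof (rule ccontr)
      assume "\<not> (x = t \<or> x <\<^sub>b t)"
      then have tx: "t <\<^sub>b x" using t(1) x(1) bX(1) unfolding block_sequence_def by blast
      then have "x \<in> D (Suc (Max t))" using X(4) XX t(1) x(1) by blast
      then have "x \<in> D (Suc m)" using D_antimono[of "Suc m" "Suc (Max t)"] t(2) by auto
      moreover have "m < Max x" using block_less_Max[OF tx] t(2) x(1) bX(2) by auto
      ultimately show False using x(2) by (simp add: near_def)
    qed
    then have "{x \<in> X. near m x} \<subseteq> insert t {x \<in> X. x <\<^sub>b t}" by blast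
    then show ?thesis using finite_block_predecessors[OF bX(2)] finite_subset by blast
  qed
  have not_near: "{m \<in> UNIV. \<not> near m x} \<in> U" for x
  proof -
    have "UNIV - {..Max x} \<in> U" by (rule ultrafilter_compl[OF ufU]) (auto simp: selective_finite[OF U])
    from U_Int[OF this DU[of "Suc (Max x)"]] show ?thesis
      by (rule ultrafilter_superset[OF ufU]) (auto simp: near_def)
  qed
  \<comment> \<open>Besides being legal after \<open>m\<close>, the number \<open>m'\<close> must
    avoid the finitely many blocks near \<open>m\<close>; then no block is near two members of
    \<open>B0\<close>.\<close>
  define DU' where "DU' m = DU (Suc m) \<inter> {m' \<in> UNIV. \<forall>x\<in>{x \<in> X. near m x}. \<not> near m' x}" for m
  have "DU' m \<in> U" for m
    unfolding DU'_def by (intro U_Int DU U_finite_INT[OF near_finite] not_near)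
  from selective_diagonal[of U DU', OF U this] obtain B0 where
    B0: "B0 \<in> U" "\<forall>m\<in>B0. \<forall>m'\<in>B0. m < m' \<longrightarrow> m' \<in> DU' m" by (elim bexE)
  have near_less: "\<not> m < m'" if m: "m \<in> B0" "m' \<in> B0" "x \<in> X" "near m x" "near m' x" for m m' x
  proof
    assume "m < m'"
    then have "m' \<in> DU' m" using B0(2) m(1,2) by simp
    then show False using m(3-5) by (simp add: DU'_def)
  qed
  have near_unique: "m = m'" if "m \<in> B0" "m' \<in> B0" "x \<in> X" "near m x" "near m' x" for m m' x
    using near_less[OF that] near_less[OF that(2,1,3,5,4)] by simp
  let ?S = "\<lambda>B. {u \<in> \<langle>X\<rangle>. \<exists>x\<in>X. Max x = Max u \<and> (\<exists>m\<in>B. near m x)}"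
  obtain B1 where B1: "B1 \<in> U" "?S B1 \<notin> H"
  proof -
    \<comment> \<open>At other arguments the description is arbitrary; only its values at
      \<open>Max u\<close> for \<open>u\<close> in \<open>?S (B0 \<inter> B)\<close> matter.\<close>
    define \<psi> where "\<psi> l = (THE m. m \<in> B0 \<and> (\<exists>x\<in>X. Max x = l \<and> near m x))" for l
    obtain B where B: "B \<in> U" "{s \<in> FIN. \<psi> (Max s) \<in> B} \<notin> H" using not_image by blast
    have "?S (B0 \<inter> B) \<subseteq> {s \<in> FIN. \<psi> (Max s) \<in> B}"
    proof clarify
      fix u x m assume *: "u \<in> \<langle>X\<rangle>" "x \<in> X" "Max x = Max u" "m \<in> B0" "m \<in> B" "near m x"
      have "\<psi> (Max u) = m"
        unfolding \<psi>_def
      proof (rule the_equality)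
        show "m \<in> B0 \<and> (\<exists>x\<in>X. Max x = Max u \<and> near m x)" using * by blast
        fix m' assume m': "m' \<in> B0 \<and> (\<exists>x\<in>X. Max x = Max u \<and> near m' x)"
        then obtain x' where x': "x' \<in> X" "Max x' = Max u" "near m' x'" by blast
        have "x' = x" using block_sequence_Max_inj[OF bX(1)] x' * by (metis inj_onD)
        then show "m' = m" using near_unique * m' x'(3) by blast
      qed
      then show "u \<in> FIN \<and> \<psi> (Max u) \<in> B" using * finite_unions_subset_FIN by blast
    qed
    then have "?S (B0 \<inter> B) \<notin> H" using B(2) H_superset[of "?S (B0 \<inter> B)"] by auto
    then show ?thesis using that[of "B0 \<inter> B"] U_Int[OF B0(1) B(1)] by blast
  qed
  \<comment> \<open>Membership in \<open>DU 0\<close> makes a number legal as the first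
    move.\<close>
  define B where "B = B0 \<inter> B1 \<inter> DU 0"
  have B: "B \<in> U" unfolding B_def by (intro U_Int B0(1) B1(1) DU)
  define Y where "Y = {x \<in> X. \<forall>m\<in>B. \<not> near m x}"
  have HY: "{u \<in> \<langle>X\<rangle>. \<exists>y\<in>Y. Max y = Max u} \<in> H"
  proof -
    have sub: "\<langle>X\<rangle> \<inter> (FIN - ?S B1) \<subseteq> {u \<in> \<langle>X\<rangle>. \<exists>y\<in>Y. Max y = Max u}"
    proof
      fix u assume u: "u \<in> \<langle>X\<rangle> \<inter> (FIN - ?S B1)"
      then obtain x where x: "x \<in> X" "Max x = Max u" using finite_unions_Max[OF bX(1)] by blast
      then have "x \<in> Y" using u unfolding Y_def B_def by blast
      then show "u \<in> {u \<in> \<langle>X\<rangle>. \<exists>y\<in>Y. Max y = Max u}" using u x by blast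
    qed
    have "FIN - ?S B1 \<in> H"
      using B1(2) finite_unions_subset_FIN by (intro H_compl) auto
    show ?thesis
    proof (rule H_superset[OF H_Int[OF X(2) \<open>FIN - ?S B1 \<in> H\<close>] sub])
      show "{u \<in> \<langle>X\<rangle>. \<exists>y\<in>Y. Max y = Max u} \<subseteq> FIN" using finite_unions_subset_FIN[of X] by auto
    qed
  qed
  let ?E = "Inl ` Y \<union> Inr ` B"
  have YX: "Y \<subseteq> X" by (auto simp: Y_def)
  have YB: "y \<in> D (Suc m)" if "m \<in> B" "y \<in> Y" "m < Max y" for m y
    using that by (auto simp: Y_def near_def)
  have BY: "m \<in> DU (Suc (Max y))" if "m \<in> B" "y \<in> Y" "Max y < m" for m y
    using that by (auto simp: Y_def near_def)
  have neq: "m \<noteq> Max y" if "m \<in> B" "y \<in> Y" for m y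
    using that by (auto simp: Y_def near_def)
  obtain q where q: "q \<subseteq> p0" "(\<forall>k. big_set q k \<in> H) \<longrightarrow> q \<in> \<P> H"
    and qe: "\<forall>e\<in>?E. \<exists>l \<sigma> p'. l \<le> \<tau> e \<and> (l = 0 \<or> (\<exists>e'\<in>?E. l = Suc (\<tau> e'))) \<and> \<sigma> \<in> reach l \<and>
      (\<forall>e'\<in>?E. \<tau> e' < \<tau> e \<longrightarrow> \<tau> e' < snd \<sigma>) \<and> R (fst \<sigma>) (snd \<sigma>) e p' \<and> p' \<in> \<P> H \<and> q \<subseteq> p' \<and>
      (\<forall>m\<le>Suc (\<tau> e). Lev m q = Lev m p')"
  proof (rule play[of ?E])
    show "?E \<subseteq> Inl ` FIN \<union> range Inr" using YX bX(2) by blast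
    show "inj_on \<tau> ?E"
    proof (rule inj_onI)
      fix e e' assume e: "e \<in> ?E" "e' \<in> ?E" "\<tau> e = \<tau> e'"
      have "inj_on Max Y" using block_sequence_Max_inj[OF bX(1)] YX by (rule inj_on_subset)
      then have Y_inj: "y = y'" if "y \<in> Y" "y' \<in> Y" "Max y = Max y'" for y y'
        using inj_onD[OF _ that(3,1,2)] by blast
      show "e = e'"
      proof (cases e; cases e')
        fix y y' assume "e = Inl y" "e' = Inl y'"
        then show ?thesis using e Y_inj[of y y'] by (auto simp: \<tau>_def)
      next
        fix y m assume "e = Inl y" "e' = Inr m"
        then show ?thesis using e neq[of m y] by (auto simp: \<tau>_def)
      next
        fix m y assume "e = Inr m" "e' = Inl y"
        then show ?thesis using e neq[of m y] by (auto simp: \<tau>_def)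
      next
        fix m m' assume "e = Inr m" "e' = Inr m'"
        then show ?thesis using e(3) by (simp add: \<tau>_def)
      qed
    qed
    show "\<exists>e\<in>?E. n \<le> \<tau> e" for n
    proof -
      have "\<not> B \<subseteq> {..<n}" using selective_finite[OF U] B finite_subset by blast
      then obtain m where "m \<in> B" "n \<le> m" by force
      then show ?thesis by (intro bexI[of _ "Inr m"]) (auto simp: \<tau>_def)
    qed
    fix e l \<sigma>
    assume e: "e \<in> ?E" "l \<le> \<tau> e" "l = 0 \<or> (\<exists>e'\<in>?E. l = Suc (\<tau> e'))" "\<sigma> \<in> reach l"
    show "\<exists>p'. R (fst \<sigma>) (snd \<sigma>) e p'"
    proof (cases e)
      \<comment> \<open>Freezing is always legal in the game; that the block is big in the state
        where it is played is verified after the play.\<close>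
      case (Inl x)
      then show ?thesis using reach_state[OF e(4)] by (simp add: R_def)
    next
      case (Inr m)
      then have m: "m \<in> B" "l \<le> m" using e(1,2) by (auto simp: \<tau>_def)
      have "m \<in> DU l"
        using e(3)
      proof
        assume "l = 0"
        then show ?thesis using m(1) by (simp add: B_def)
      next
        assume "\<exists>e'\<in>?E. l = Suc (\<tau> e')"
        then consider y where "y \<in> Y" "l = Suc (Max y)" | m' where "m' \<in> B" "l = Suc m'"
          by (auto simp: \<tau>_def)
        then show ?thesis
        proof cases
          case 1
          then show ?thesis using BY[OF m(1) 1(1)] m(2) by simp
        next
          case 2
          then have "m \<in> DU' m'" using B0(2) m by (simp add: B_def)
          then show ?thesis using 2 by (simp add: DU'_def)
        qed
      qed
      then show ?thesis using e(4) Inr by (simp add: DU_def)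
    qed
  qed (rule that)
  have "big_set q k \<in> H" for k
  proof (rule big_set_in_H[OF X(1) YX HY])
    fix t y assume ty: "t \<in> X" "y \<in> Y" "t <\<^sub>b y"
    have yX: "y \<in> X" using ty(2) YX by blast
    obtain l \<sigma> p' where l: "l \<le> \<tau> (Inl y)" "l = 0 \<or> (\<exists>e'\<in>?E. l = Suc (\<tau> e'))" "\<sigma> \<in> reach l"
      "R (fst \<sigma>) (snd \<sigma>) (Inl y) p'" "\<forall>m\<le>Suc (\<tau> (Inl y)). Lev m q = Lev m p'"
      using bspec[OF qe, of "Inl y"] ty(2) by blast
    have yDt: "y \<in> D (Suc (Max t))" using X(4) XX ty yX by blast
    have yDl: "y \<in> D l"
      using l(2)
    proof
      assume "l = 0"
      then show ?thesis using X(3) XX yX by blast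
    next
      assume "\<exists>e'\<in>?E. l = Suc (\<tau> e')"
      then consider x where "x \<in> Y" "l = Suc (Max x)" | m where "m \<in> B" "l = Suc m"
        by (auto simp: \<tau>_def)
      then show ?thesis
      proof cases
        case 1
        then have "x \<in> X" "Max x < Max y" using YX l(1) by (auto simp: \<tau>_def)
        then have "x <\<^sub>b y" using block_sequence_Max_less[OF bX(1) _ yX] by blast
        then show ?thesis using X(4) XX \<open>x \<in> X\<close> yX 1(2) by blast
      next
        case 2
        then show ?thesis using YB[OF 2(1) ty(2)] l(1) by (simp add: \<tau>_def)
      qed
    qed
    \<comment> \<open>The state lies in \<open>reach l\<close>, but a block \<open>t\<close> outside
      \<open>Y\<close> is never played and may end after the last move, so
      \<open>Suc (Max t)\<close> can exceed \<open>l\<close>. The larger index covers both.\<close>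
    have "y \<in> D (max l (Suc (Max t)))" using yDt yDl by (simp add: max_def)
    moreover have "\<sigma> \<in> reach (max l (Suc (Max t)))" by (rule subsetD[OF reach_mono l(3)]) simp
    ultimately have "y \<in> big_set (fst \<sigma>) (max l (Suc (Max t)))" by (simp add: D_def)
    then have "y \<in> big_set (fst \<sigma>) (Suc (Max t))"
      using big_set_antimono[of "Suc (Max t)" "max l (Suc (Max t))"] by auto
    moreover have "p' = fst \<sigma>" using l(4) by (simp add: R_def)
    ultimately show "y \<in> big_set q (Suc (Max t))"
      using big_set_cong[of y q p'] l(5) by (simp add: \<tau>_def)
  qed
  then have qP: "q \<in> \<P> H" using q(2) by simp
  have "\<Phi> m q" if m: "m \<in> B" for m
  proof -
    obtain \<sigma> p' where "R (fst \<sigma>) (snd \<sigma>) (Inr m) p'" "p' \<in> \<P> H" "q \<subseteq> p'"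
      using bspec[OF qe, of "Inr m"] m by blast
    then have "\<Phi> m p'" "p' \<in> \<P> H" "q \<subseteq> p'" by (simp_all add: R_def)
    then show ?thesis using reg[of m] qP unfolding regular_open_def by meson
  qed
  then show ?thesis using q(1) qP B by blast
qed

text \<open>Either the fusion for \<Phi> works below \<open>p\<close>, or its hypothesis fails at
  some \<open>r\<close>, and the failure helps \<Psi>. In the image case,
  \<open>good_dichotomy\<close> provides the hypothesis of the fusion for \<Psi> below
  \<open>r\<close>. Otherwise, for \<open>U\<close>-many \<open>n\<close> no condition below
  \<open>r\<close> satisfies \<open>\<Phi> n\<close>, so \<open>r\<close> itself satisfies
  \<open>\<Psi> n\<close> by density.\<close>

lemma selective_decision:
  assumes U: "selective_ultrafilter U"
    and reg: "\<And>n. regular_open (\<P> H) (\<Phi> n)" "\<And>n. regular_open (\<P> H) (\<Psi> n)"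
    and dec: "\<And>n p. p \<in> \<P> H \<Longrightarrow> \<exists>q\<in>\<P> H. q \<subseteq> p \<and> (\<Phi> n q \<or> \<Psi> n q)"
    and p: "p \<in> \<P> H"
  shows "\<exists>q\<in>\<P> H. q \<subseteq> p \<and> (\<exists>B\<in>U. (\<forall>n\<in>B. \<Phi> n q) \<or> (\<forall>n\<in>B. \<Psi> n q))"
proof -
  have ufU: "ultrafilter_on UNIV U" using U by (simp add: selective_ultrafilter_def)
  show ?thesis
  proof (cases "\<exists>\<psi>. \<forall>B\<in>U. {s \<in> FIN. \<psi> (Max s) \<in> B} \<in> H")
    case True
    then obtain \<psi> where \<psi>: "\<And>B. B \<in> U \<Longrightarrow> {s \<in> FIN. \<psi> (Max s) \<in> B} \<in> H" by blast
    show ?thesis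
    proof (cases "\<forall>r\<in>\<P> H. r \<subseteq> p \<longrightarrow> (\<forall>k. good \<psi> \<Phi> r k \<in> H)")
      case True
      then show ?thesis using image_of_max_fusion[of U \<psi> \<Phi> p, OF ufU \<psi> reg(1) p] by meson
    next
      case False
      then obtain r k where r: "r \<in> \<P> H" "r \<subseteq> p" "good \<psi> \<Phi> r k \<notin> H" by blast
      have "good \<psi> \<Psi> r' k' \<in> H" if r': "r' \<in> \<P> H" "r' \<subseteq> r" for r' k'
      proof -
        have FIN: "good \<psi> \<Xi> r'' k'' \<subseteq> FIN" for \<Xi> r'' k'' by (auto simp: good_def)
        \<comment> \<open>Failure at \<open>k\<close> persists for larger parameters, while success
          at the maximum passes down to \<open>k'\<close>.\<close>
        have "good \<psi> \<Phi> r' (max k k') \<notin> H"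
          using r(3) H_superset[OF _ good_mono[OF r'(2), of k "max k k'"] FIN] by auto
        moreover have "good \<psi> \<Phi> r' (max k k') \<in> H \<or> good \<psi> \<Psi> r' (max k k') \<in> H"
          by (rule good_dichotomy) (use reg dec r'(1) in simp_all)
        ultimately have "good \<psi> \<Psi> r' (max k k') \<in> H" by simp
        from H_superset[OF this good_mono[OF order_refl, of k'] FIN] show ?thesis by simp
      qed
      then obtain q where "q \<in> \<P> H" "q \<subseteq> r" "\<exists>B\<in>U. \<forall>n\<in>B. \<Psi> n q"
        using image_of_max_fusion[of U \<psi> \<Psi> r, OF ufU \<psi> reg(2) r(1)] by blast
      then show ?thesis using r(2) by (meson order_trans)
    qed
  next
    case False
    show ?thesis
    proof (cases "\<forall>r\<in>\<P> H. r \<subseteq> p \<longrightarrow> {n. \<exists>q\<in>\<P> H. q \<subseteq> r \<and> \<Phi> n q} \<in> U")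
      case True
      have "\<exists>B\<in>U. {s \<in> FIN. \<psi> (Max s) \<in> B} \<notin> H" for \<psi> using False by blast
      then show ?thesis using not_image_of_max_fusion[of U \<Phi> p, OF U _ reg(1) p] True by meson
    next
      case False
      then obtain r where r: "r \<in> \<P> H" "r \<subseteq> p" "{n. \<exists>q\<in>\<P> H. q \<subseteq> r \<and> \<Phi> n q} \<notin> U" by blast
      have "UNIV - {n. \<exists>q\<in>\<P> H. q \<subseteq> r \<and> \<Phi> n q} \<in> U" using r(3) by (intro ultrafilter_compl[OF ufU]) auto
      moreover have "\<Psi> n r" if n: "n \<in> UNIV - {n. \<exists>q\<in>\<P> H. q \<subseteq> r \<and> \<Phi> n q}" for n
      proof -
        have "\<exists>q'\<in>\<P> H. q' \<subseteq> q \<and> \<Psi> n q'" if q: "q \<in> \<P> H" "q \<subseteq> r" for q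
        proof -
          obtain q' where q': "q' \<in> \<P> H" "q' \<subseteq> q" "\<Phi> n q' \<or> \<Psi> n q'" using dec[OF q(1)] by blast
          have "q' \<subseteq> r" using q'(2) q(2) by (rule order_trans)
          then have "\<not> \<Phi> n q'" using n q'(1) by blast
          then show ?thesis using q' by blast
        qed
        then show ?thesis using reg(2)[of n] r(1) unfolding regular_open_def by meson
      qed
      ultimately show ?thesis using r(1,2) by meson
    qed
  qed
qed

end

section \<open>Preservation of selective ultrafilters\<close>

theorem theorem6p14:
  fixes H :: "nat set set set"
  assumes "stable_ordered_union_ultrafilter H"
  shows "\<forall>U. selective_ultrafilter U \<longrightarrow> preserves (\<P> H) (\<subseteq>) U"
proof (intro allI impI)
  fix U assume U: "selective_ultrafilter U"
  interpret stable_ordered_union H by unfold_locales (rule assms)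
  interpret forcing_preorder "\<P> H" "(\<subseteq>)" by unfold_locales auto
  have reg: "regular_open (\<P> H) (forces (\<P> H) (\<subseteq>) \<phi>)" for \<phi>
    unfolding regular_open_def using forces_mono forces_dense by meson
  have decides: "\<exists>q\<in>\<P> H. q \<subseteq> p \<and> (forces (\<P> H) (\<subseteq>) \<phi> q \<or> forces (\<P> H) (\<subseteq>) (\<^bold>\<not> \<phi>) q)"
    if "p \<in> \<P> H" for p \<phi>
    using that unfolding forces.simps by blast
  show "preserves (\<P> H) (\<subseteq>) U"
  proof (rule preservesI)
    show "ultrafilter_on UNIV U" using U by (simp add: selective_ultrafilter_def)
    show "\<exists>q\<in>\<P> H. q \<subseteq> p \<and> (\<exists>B\<in>U.
        (\<forall>n\<in>B. forces (\<P> H) (\<subseteq>) (check_nat (\<P> H) n \<^bold>\<in> A) q) \<or>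
        (\<forall>n\<in>B. forces (\<P> H) (\<subseteq>) (\<^bold>\<not> check_nat (\<P> H) n \<^bold>\<in> A) q))"
      if "p \<in> \<P> H" for A p
      by (rule selective_decision[OF U reg reg decides that])
  qed
qed

end
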